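(* Let $M\subset\mathcal V$ be a semi-algebraic set of dimension $k$, $k\le\dim(\mathcal V)$. Assume $M$ is invariant under $U_g$ for each $g\in G$, i.e. $U_g(M)\subset M$. Let $p\ge 2k+1$ be an integer. Then for a generic $\mathbf w=(w_1,\dots,w_p)\in\mathcal V^p$ with respect to the Zariski topology the following holds: for every $S\subset[N]\times[p]$ such that $S_i\ne\emptyset$ for all $i\in[p]$, the restricted map $\hat\Phi_{\mathbf w,S}|_{\hat M}:\hat M\to\mathbb R^{|S|}$ is injective, where $\hat M=\{[x]:x\in M\}\subset\hat{\mathcal V}$.
   Context: $(\mathcal V,\langle\cdot,\cdot\rangle)$ is a real inner product space of finite dimension $d\ge 2$, and $G$ is a finite group of order $|G|=N$ acting unitarily on $\mathcal V$: each $g\in G$ acts by a linear isometry $U_g$ of $\mathcal V$. Write $x\sim y$ if $y=U_gx$ for some $g\in G$, $[x]=\{U_gx:g\in G\}$, and $\hat{\mathcal V}=\mathcal V/\sim$. Write $[r]=\{1,\dots,r\}$. For $w,x\in\mathcal V$ and $j\in[N]$, $\Phi_{w,j}(x)$ is the $j$-th entry of the vector obtained by sorting the $N$ numbers $(\langle U_gw,x\rangle)_{g\in G}$ (with repetitions) in decreasing order. For $\mathbf w=(w_1,\dots,w_p)\in\mathcal V^p$ and $S\subset[N]\times[p]$, let $S_i=\{k\in[N]:(k,i)\in S\}$ for $i\in[p]$, and $$\Phi_{\mathbf w,S}:\mathcal V\to\mathbb R^{|S|},\qquad \Phi_{\mathbf w,S}(x)=\big[\{\Phi_{w_1,j}(x)\}_{j\in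 S_1},\dots,\{\Phi_{w_p,j}(x)\}_{j\in S_p}\big].$$ This map is $G$-invariant and so induces $\hat\Phi_{\mathbf w,S}:\hat{\mathcal V}\to\mathbb R^{|S|}$, $\hat\Phi_{\mathbf w,S}([x])=\Phi_{\mathbf w,S}(x)$. Semi-algebraic sets and their dimension are the usual ones (Bochnak–Coste–Roy), with $\mathcal V\cong\mathbb R^d$. A property holds for generic $\mathbf w\in\mathcal V^p$ with respect to the Zariski topology if it holds for all $\mathbf w$ in some nonempty Zariski-open subset of $\mathcal V^p\cong\mathbb R^{dp}$. *)

theory Defs
  imports
    "HOL-Analysis.Analysis"
    "HOL-Algebra.Group_Action"
    "HOL-Algebra.QuotRing"
begin

section \<open>Semi-algebraic sets and their dimension\<close>

text \<open>
  On a Euclidean space, \<^const>\<open>real_polynomial_function\<close> is the algebra generated by the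
  constants and the linear functionals, i.e. the functions that are polynomial in the
  coordinates with respect to any basis.
\<close>

inductive semialgebraic :: "'a::euclidean_space set \<Rightarrow> bool" where
  positivity: "real_polynomial_function f \<Longrightarrow> semialgebraic {x. f x > 0}"
| union: "semialgebraic A \<Longrightarrow> semialgebraic B \<Longrightarrow> semialgebraic (A \<union> B)"
| intersection: "semialgebraic A \<Longrightarrow> semialgebraic B \<Longrightarrow> semialgebraic (A \<inter> B)"
| complement: "semialgebraic A \<Longrightarrow> semialgebraic (- A)"

text \<open>
  Following Bochnak, Coste and Roy, the dimension of \<open>A \<subseteq> \<real>\<^sup>d\<close> is the Krull dimension of
  \<open>\<real>[X\<^sub>1, \<dots>, X\<^sub>d] / I(A)\<close>. The polynomial ring is realised as the ring of polynomial functions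
  on the whole space, which is faithful because \<open>\<real>\<close> is infinite.
\<close>

definition polynomial_ring :: "('a::euclidean_space \<Rightarrow> real) ring" where
  "polynomial_ring =
     \<lparr>carrier = Collect real_polynomial_function,
      mult = (\<lambda>f g x. f x * g x), one = (\<lambda>x. 1),
      zero = (\<lambda>x. 0), add = (\<lambda>f g x. f x + g x)\<rparr>"

definition vanishing_ideal :: "'a::euclidean_space set \<Rightarrow> ('a \<Rightarrow> real) set" where
  "vanishing_ideal A = {f. real_polynomial_function f \<and> (\<forall>x\<in>A. f x = 0)}"

text \<open>
  The supremum is taken in the extended reals, so the zero ring, which has no prime ideal,
  has dimension \<open>-\<infinity>\<close>; this is the dimension of the empty set below.
\<close>

definition krull_dim :: "('r, 's) ring_scheme \<Rightarrow> ereal" where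
  "krull_dim R =
     Sup {ereal (real n) | n.
       \<exists>P. (\<forall>i\<le>n. primeideal (P i) R) \<and> (\<forall>i<n. P i \<subset> P (Suc i))}"

definition semialg_dim :: "'a::euclidean_space set \<Rightarrow> ereal" where
  "semialg_dim A = krull_dim (polynomial_ring Quot vanishing_ideal A)"

lemma cring_polynomial_ring: "cring (polynomial_ring :: ('a::euclidean_space \<Rightarrow> real) ring)"
proof (rule cringI)
  show "abelian_group (polynomial_ring :: ('a \<Rightarrow> real) ring)"
  proof (rule abelian_groupI)
    fix f :: "'a \<Rightarrow> real"
    assume "f \<in> carrier polynomial_ring"
    then have "real_polynomial_function (\<lambda>x. (-1) * f x)"
      by (intro real_polynomial_function.intros(2,4))
        (simp add: polynomial_ring_def)
    then show "\<exists>g\<in>carrier polynomial_ring. g \<oplus>\<^bsub>polynomial_ring\<^esub> f = \<zero>\<^bsub>polynomial_ring\<^esub>"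
      by (intro bexI[of _ "\<lambda>x. (-1) * f x"]) (auto simp: polynomial_ring_def)
  qed (auto simp: polynomial_ring_def algebra_simps)
  show "comm_monoid (polynomial_ring :: ('a \<Rightarrow> real) ring)"
    by (rule comm_monoidI) (auto simp: polynomial_ring_def algebra_simps)
qed (auto simp: polynomial_ring_def algebra_simps)

lemma ideal_vanishing_ideal: "ideal (vanishing_ideal A) polynomial_ring"
proof -
  interpret cring "polynomial_ring :: ('a \<Rightarrow> real) ring"
    by (rule cring_polynomial_ring)
  show ?thesis
  proof (rule idealI)
    show "ring (polynomial_ring :: ('a \<Rightarrow> real) ring)"
      by (rule ring_axioms)
    show "subgroup (vanishing_ideal A) (add_monoid polynomial_ring)"
    proof (rule add.subgroupI)
      fix f
      assume f: "f \<in> vanishing_ideal A"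
      then have rf: "real_polynomial_function (\<lambda>x. (-1) * f x)"
        by (intro real_polynomial_function.intros(2,4))
          (simp add: vanishing_ideal_def)
      have "\<ominus>\<^bsub>polynomial_ring\<^esub> f = (\<lambda>x. (-1) * f x)"
        using f rf by (intro minus_equality) (auto simp: polynomial_ring_def vanishing_ideal_def)
      then show "\<ominus>\<^bsub>polynomial_ring\<^esub> f \<in> vanishing_ideal A"
        using f rf by (simp add: vanishing_ideal_def)
    qed (auto simp: polynomial_ring_def vanishing_ideal_def)
  qed (auto simp: polynomial_ring_def vanishing_ideal_def)
qed

lemma semialg_dim_empty: "semialg_dim ({} :: 'a::euclidean_space set) = -\<infinity>"
proof -
  interpret ideal "vanishing_ideal ({} :: 'a set)" polynomial_ring
    by (rule ideal_vanishing_ideal)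
  have V: "vanishing_ideal ({} :: 'a set) = carrier polynomial_ring"
    by (auto simp: vanishing_ideal_def polynomial_ring_def)
  have carr: "carrier (polynomial_ring Quot vanishing_ideal ({} :: 'a set))
              = {vanishing_ideal {}}" (is "carrier ?Q = _")
  proof -
    have "vanishing_ideal {} +>\<^bsub>polynomial_ring\<^esub> a = vanishing_ideal ({} :: 'a set)"
      if "a \<in> carrier polynomial_ring" for a :: "'a \<Rightarrow> real"
      using that by (intro a_rcos_const) (simp add: V)
    then show ?thesis
      unfolding FactRing_def A_RCOSETS_def' by force
  qed
  have "\<not> primeideal P ?Q" for P
  proof
    assume "primeideal P ?Q"
    then interpret P: primeideal P ?Q .
    have "P \<subseteq> carrier ?Q" "\<zero>\<^bsub>?Q\<^esub> \<in> P" "\<zero>\<^bsub>?Q\<^esub> \<in> carrier ?Q"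
      using P.a_subset P.additive_subgroup_axioms additive_subgroup.zero_closed by auto
    then have "P = carrier ?Q"
      by (metis carr empty_iff singletonD subset_singletonD)
    then show False
      using P.I_notcarr by simp
  qed
  then have "{ereal (real n) | n.
       \<exists>P. (\<forall>i\<le>n. primeideal (P i) ?Q) \<and> (\<forall>i<n. P i \<subset> P (Suc i))} = {}"
    by blast
  then show ?thesis
    unfolding semialg_dim_def krull_dim_def by (simp only: Sup_empty bot_ereal_def)
qed


section \<open>Zariski-generic properties\<close>

definition zariski_closed :: "'a::euclidean_space set \<Rightarrow> bool" where
  "zariski_closed Z \<longleftrightarrow>
     (\<exists>F. (\<forall>f\<in>F. real_polynomial_function f) \<and> Z = {x. \<forall>f\<in>F. f x = 0})"

definition zariski_open :: "'a::euclidean_space set \<Rightarrow> bool" where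
  "zariski_open W \<longleftrightarrow> zariski_closed (- W)"

definition zariski_generic :: "('a::euclidean_space \<Rightarrow> bool) \<Rightarrow> bool" where
  "zariski_generic Q \<longleftrightarrow> (\<exists>W. zariski_open W \<and> W \<noteq> {} \<and> (\<forall>w\<in>W. Q w))"


section \<open>Sorted coorbit maps\<close>

text \<open>The index \<open>j\<close> ranges over \<open>{1..order G}\<close>, whereas list positions start at \<open>0\<close>.\<close>

definition sorted_coorbit ::
  "('g, 'b) monoid_scheme \<Rightarrow> ('g \<Rightarrow> 'a::euclidean_space \<Rightarrow> 'a) \<Rightarrow> 'a \<Rightarrow> nat \<Rightarrow> 'a \<Rightarrow> real" where
  "sorted_coorbit G U w j x =
     rev (sorted_list_of_multiset (image_mset (\<lambda>g. U g w \<bullet> x) (mset_set (carrier G)))) ! (j - 1)"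

text \<open>
  A tuple in \<open>V\<^sup>p\<close> is an element of \<open>'a ^ 'p\<close> with \<open>p = CARD('p)\<close>. The space \<open>\<real>\<^sup>|\<^sup>S\<^sup>|\<close> is the
  space of real families indexed by \<open>S\<close>, represented by functions that are
  \<^const>\<open>undefined\<close> outside \<open>S\<close>.
\<close>

definition coorbit_map ::
  "('g, 'b) monoid_scheme \<Rightarrow> ('g \<Rightarrow> 'a::euclidean_space \<Rightarrow> 'a) \<Rightarrow> 'a ^ 'p \<Rightarrow> (nat \<times> 'p) set \<Rightarrow>
   'a \<Rightarrow> (nat \<times> 'p \<Rightarrow> real)" where
  "coorbit_map G U w S x = (\<lambda>(j, i)\<in>S. sorted_coorbit G U (w $ i) j x)"

text \<open>
  The map induced on orbits: for an orbit \<open>X\<close>, the common value of the coorbit map on \<open>X\<close>;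
  see \<open>induced_coorbit_map_orbit\<close> below.
\<close>

definition induced_coorbit_map ::
  "('g, 'b) monoid_scheme \<Rightarrow> ('g \<Rightarrow> 'a::euclidean_space \<Rightarrow> 'a) \<Rightarrow> 'a ^ 'p \<Rightarrow> (nat \<times> 'p) set \<Rightarrow>
   'a set \<Rightarrow> (nat \<times> 'p \<Rightarrow> real)" where
  "induced_coorbit_map G U w S X = the_elem (coorbit_map G U w S ` X)"

lemma sorted_coorbit_invariant:
  fixes U :: "'g \<Rightarrow> 'a::euclidean_space \<Rightarrow> 'a"
  assumes act: "group_action G UNIV U"
    and orth: "\<And>g. g \<in> carrier G \<Longrightarrow> orthogonal_transformation (U g)"
    and h: "h \<in> carrier G"
  shows "sorted_coorbit G U w j (U h x) = sorted_coorbit G U w j x"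
proof -
  interpret group_action G UNIV U by (rule act)
  interpret group G using group_hom group_hom.axioms(1) by auto
  have bij: "bij_betw (\<lambda>g. h \<otimes>\<^bsub>G\<^esub> g) (carrier G) (carrier G)"
    using h inj_on_multc surj_const_mult
    by (auto simp: bij_betw_def inj_on_def)
  have "U (h \<otimes>\<^bsub>G\<^esub> g) w \<bullet> U h x = U g w \<bullet> x" if "g \<in> carrier G" for g
    using that h orth[OF h] composition_rule[of w h g]
    by (simp add: orthogonal_transformation_def)
  then have "image_mset (\<lambda>g. U g w \<bullet> x) (mset_set (carrier G))
      = image_mset (\<lambda>g. U (h \<otimes>\<^bsub>G\<^esub> g) w \<bullet> U h x) (mset_set (carrier G))"
    by (cases "finite (carrier G)") (auto intro!: image_mset_cong)
  also have "\<dots> = image_mset (\<lambda>g. U g w \<bullet> U h x)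
        (image_mset (\<lambda>g. h \<otimes>\<^bsub>G\<^esub> g) (mset_set (carrier G)))"
    by (simp add: multiset.map_comp comp_def)
  also have "image_mset (\<lambda>g. h \<otimes>\<^bsub>G\<^esub> g) (mset_set (carrier G)) = mset_set (carrier G)"
    using bij by (simp add: image_mset_mset_set bij_betw_def)
  finally show ?thesis
    by (simp add: sorted_coorbit_def)
qed

lemma induced_coorbit_map_orbit:
  fixes U :: "'g \<Rightarrow> 'a::euclidean_space \<Rightarrow> 'a"
  assumes act: "group_action G UNIV U"
    and orth: "\<And>g. g \<in> carrier G \<Longrightarrow> orthogonal_transformation (U g)"
  shows "induced_coorbit_map G U w S (orbit G U x) = coorbit_map G U w S x"
proof -
  have eq: "coorbit_map G U w S y = coorbit_map G U w S x" if "y \<in> orbit G U x" for y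
    using that sorted_coorbit_invariant[OF act orth]
    by (auto simp: orbit_def coorbit_map_def)
  have "x \<in> orbit G U x"
    using group_action.orbit_refl[OF act] by auto
  then have "coorbit_map G U w S ` orbit G U x = {coorbit_map G U w S x}"
    using eq by blast
  then show ?thesis
    by (simp add: induced_coorbit_map_def)
qed

end

theory Submission
  imports Defs "Jordan_Normal_Form.Determinant"
begin

text \<open>
  Suppose that \<open>w\<close> fails to separate the orbits of \<open>x, y \<in> M\<close>. Every sorted entry is attained by
  some group element, so for each \<open>i\<close> there are \<open>g\<^sub>i, h\<^sub>i \<in> G\<close> for which \<open>w\<^sub>i\<close> is orthogonal to
  \<open>v\<^sub>i = U g\<^sub>i x - U h\<^sub>i y\<close>; and \<open>v\<^sub>i \<noteq> 0\<close> because the orbits differ. The bad tuples are therefore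
  covered by finitely many projections of incidence sets
  \<open>{(x, y, w). x, y \<in> M, w\<^sub>i \<bullet> v\<^sub>i = 0, v\<^sub>i \<bullet> c\<^sub>i \<noteq> 0}\<close>, one for each choice of the \<open>g\<^sub>i\<close>, the \<open>h\<^sub>i\<close> and a
  basis vector \<open>c\<^sub>i\<close> that detects \<open>v\<^sub>i \<noteq> 0\<close>. On such a set the coordinate of \<open>w\<^sub>i\<close> along \<open>c\<^sub>i\<close> is a
  rational function of the other coordinates, so at most \<open>2 k + p (d - 1)\<close> of the coordinates are
  independent. This is less than \<open>p d\<close>, the number of coordinates of \<open>w\<close>, as soon as \<open>2 k < p\<close>;
  hence some nonzero polynomial in \<open>w\<close> alone vanishes on the incidence set
  (\<open>incidence_polynomial\<close>). The product of these finitely many polynomials is nonzero, and \<open>w\<close>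
  is good wherever it does not vanish.

  The notion of dimension that does the counting is the size of a set \<open>T\<close> of coordinates that is
  algebraically independent on \<open>M\<close> (\<open>alg_indep\<close>). Three facts about it carry the proof.

  \<^item> A set whose functions are finite, up to denominators, over \<open>r\<close> functions carries at most \<open>r\<close>
    algebraically independent functions (\<open>algebraic_dependence\<close>): there are \<open>n ^ q\<close> monomials
    with exponents below \<open>n\<close> in \<open>q\<close> functions, and up to a common denominator they lie in a
    space of dimension \<open>O(n ^ r)\<close>.

  \<^item> \<open>M\<close> is a finite union of pieces, each finite in this sense over a set of coordinates that is
    independent on \<open>M\<close> (\<open>stratification\<close>). A maximal independent \<open>T\<close> serves where its
    denominators do not vanish; where they do, \<open>T\<close> is dependent, so repeating the step there
    comes to an end.

  \<^item> If \<open>T\<close> is independent on \<open>M\<close>, then \<open>card T\<close> is at most the Krull dimension of the ring of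
    polynomial functions on \<open>M\<close> (\<open>card_alg_indep_le_semialg_dim\<close>). Were there no prime chain of length
    \<open>card T\<close>, the criterion of Coquand and Lombardi would give an identity
    \<open>y\<^sub>0 ^ m\<^sub>0 * (y\<^sub>1 ^ m\<^sub>1 * (\<dots> (1 + a\<^sub>s\<^sub>-\<^sub>1 * y\<^sub>s\<^sub>-\<^sub>1) \<dots>) + a\<^sub>0 * y\<^sub>0) = 0\<close> on \<open>M\<close> for the translated coordinates
    \<open>y\<^sub>0, \<dots>, y\<^sub>s\<^sub>-\<^sub>1\<close> in \<open>T\<close>. Finiteness over \<open>T\<close> and a determinant turn it into a polynomial identity in the
    coordinates of \<open>T\<close> alone, in which the lowest monomial in the lexicographic order survives.
\<close>

no_notation vec_index (infixl "$" 100)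
no_notation scalar_prod (infix "\<bullet>" 70)

section \<open>Prime ideals and iterated boundaries\<close>

context cring begin

lemma add_principal_ideal:
  assumes I: "ideal I R" and x: "x \<in> carrier R"
  obtains J where "ideal J R" "I \<subseteq> J" "x \<in> J"
    "\<And>y. y \<in> J \<Longrightarrow> \<exists>i\<in>I. \<exists>a\<in>carrier R. y = i \<oplus> a \<otimes> x"
proof -
  interpret I: ideal I R by (rule I)
  let ?J = "set_add R I (PIdl x)"
  have J: "ideal ?J R"
    by (rule add_ideals[OF I cgenideal_ideal[OF x]])
  have 1: "I \<subseteq> ?J"
  proof
    fix i assume i: "i \<in> I"
    have "\<zero> \<in> PIdl x"
      using cgenideal_ideal[OF x] additive_subgroup.zero_closed ideal_def by blast
    moreover have "i = i \<oplus> \<zero>" using i I.a_subset by auto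
    ultimately show "i \<in> ?J" unfolding set_add_def' using i by blast
  qed
  have 2: "x \<in> ?J"
  proof -
    have "x = \<zero> \<oplus> x" using x by simp
    then show ?thesis unfolding set_add_def' using I.zero_closed cgenideal_self[OF x] by blast
  qed
  have 3: "\<exists>i\<in>I. \<exists>a\<in>carrier R. y = i \<oplus> a \<otimes> x" if "y \<in> ?J" for y
    using that unfolding set_add_def' cgenideal_def by blast
  show thesis using that[OF J 1 2 3] .
qed

text \<open>
  By Zorn's lemma there is an ideal that is maximal among those that contain \<open>I\<close> and miss \<open>S\<close>. It is
  prime: two elements outside it would each generate an element of \<open>S\<close> modulo it, and the product of
  these two elements would lie in the ideal if the product of the two generators did.
\<close>

lemma prime_ideal_avoiding:
  assumes I: "ideal I R" and S: "S \<subseteq> carrier R" "\<one> \<in> S"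
    and mult: "\<And>s t. s \<in> S \<Longrightarrow> t \<in> S \<Longrightarrow> s \<otimes> t \<in> S"
    and dis: "I \<inter> S = {}"
  obtains P where "primeideal P R" "I \<subseteq> P" "P \<inter> S = {}"
proof -
  let ?A = "{J. ideal J R \<and> I \<subseteq> J \<and> J \<inter> S = {}}"
  have "\<exists>M\<in>?A. \<forall>X\<in>?A. M \<subseteq> X \<longrightarrow> X = M"
  proof (rule subset_Zorn_nonempty)
    show "?A \<noteq> {}" using I dis by blast
    fix C assume C: "C \<noteq> {}" and ch: "subset.chain ?A C"
    from ch have CA: "\<And>J. J \<in> C \<Longrightarrow> ideal J R \<and> I \<subseteq> J \<and> J \<inter> S = {}"
      and tot: "\<And>J K. J \<in> C \<Longrightarrow> K \<in> C \<Longrightarrow> J \<subseteq> K \<or> K \<subseteq> J"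
      by (auto simp: subset_chain_def)
    have "ideal (\<Union>C) R"
    proof (rule idealI[OF ring_axioms])
      show "subgroup (\<Union>C) (add_monoid R)"
      proof (rule add.subgroupI)
        show "\<Union>C \<subseteq> carrier R"
          using CA by (meson Sup_least additive_subgroup.a_subset ideal.axioms(1))
        obtain J where J: "J \<in> C" using C by blast
        have "\<zero> \<in> J" using CA[OF J] by (simp add: additive_subgroup.zero_closed ideal.axioms(1))
        then show "\<Union>C \<noteq> {}" using J by blast
      next
        fix a assume "a \<in> \<Union>C"
        then obtain J where "J \<in> C" "a \<in> J" by blast
        then show "\<ominus> a \<in> \<Union>C"
          using CA by (meson UnionI additive_subgroup.a_inv_closed ideal.axioms(1))
      next
        fix a b assume "a \<in> \<Union>C" "b \<in> \<Union>C"
        then obtain J K where "J \<in> C" "a \<in> J" "K \<in> C" "b \<in> K" by blast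
        with tot obtain L where "L \<in> C" "a \<in> L" "b \<in> L" by blast
        then show "a \<oplus> b \<in> \<Union>C"
          using CA by (meson UnionI additive_subgroup.a_closed ideal.axioms(1))
      qed
    qed (meson CA UnionE UnionI ideal.I_l_closed ideal.I_r_closed)+
    then show "\<Union>C \<in> ?A" using CA C by blast
  qed
  then obtain P where PA: "P \<in> ?A" and maxA: "\<forall>X\<in>?A. P \<subseteq> X \<longrightarrow> X = P"
    by (rule bexE)
  from PA have P: "ideal P R" "I \<subseteq> P" "P \<inter> S = {}" by simp_all
  have max: "X = P" if "ideal X R" "I \<subseteq> X" "X \<inter> S = {}" "P \<subseteq> X" for X
    using bspec[OF maxA, of X] that by simp
  interpret P: ideal P R by (rule P)
  \<comment> \<open>By maximality every element outside \<open>P\<close> generates, together with \<open>P\<close>, an element of \<open>S\<close>.\<close>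
  have meets: "\<exists>s\<in>S. \<exists>i\<in>P. \<exists>r\<in>carrier R. s = i \<oplus> r \<otimes> a"
    if a: "a \<in> carrier R" "a \<notin> P" for a
  proof -
    obtain J where J: "ideal J R" "P \<subseteq> J" "a \<in> J"
      "\<And>y. y \<in> J \<Longrightarrow> \<exists>i\<in>P. \<exists>r\<in>carrier R. y = i \<oplus> r \<otimes> a"
      by (rule add_principal_ideal[OF P(1) a(1)]) blast
    then have "J \<inter> S \<noteq> {}" using max[of J] a P(2) by blast
    then show ?thesis using J(4) by blast
  qed
  have "primeideal P R"
  proof (rule primeidealI[OF P(1) cring_axioms])
    show "carrier R \<noteq> P" using S P(3) by blast
    fix a b assume ab: "a \<in> carrier R" "b \<in> carrier R" "a \<otimes> b \<in> P"
    show "a \<in> P \<or> b \<in> P"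
    proof (rule ccontr)
      assume "\<not> ?thesis"
      then have np: "a \<notin> P" "b \<notin> P" by auto
      obtain s i r where s: "s \<in> S" "i \<in> P" "r \<in> carrier R" "s = i \<oplus> r \<otimes> a"
        using meets[OF ab(1) np(1)] by blast
      obtain t j q where t: "t \<in> S" "j \<in> P" "q \<in> carrier R" "t = j \<oplus> q \<otimes> b"
        using meets[OF ab(2) np(2)] by blast
      have c: "i \<in> carrier R" "j \<in> carrier R" using s t P.a_subset by auto
      have "s \<otimes> t = i \<otimes> t \<oplus> (r \<otimes> a) \<otimes> j \<oplus> (r \<otimes> q) \<otimes> (a \<otimes> b)"
        unfolding s(4) t(4) using c s(3) t(3) ab by algebra
      moreover have "i \<otimes> t \<in> P" "(r \<otimes> a) \<otimes> j \<in> P" "(r \<otimes> q) \<otimes> (a \<otimes> b) \<in> P"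
        using P.I_r_closed P.I_l_closed s t ab S by auto
      ultimately have "s \<otimes> t \<in> P" using P.a_closed by simp
      then show False using mult[OF s(1) t(1)] P(3) by blast
    qed
  qed
  then show thesis using that P by blast
qed

end

text \<open>
  These are the multiplicative sets of the Coquand-Lombardi description of the Krull dimension. A prime
  ideal \<open>P\<close> that misses all elements \<open>x ^ m * (s + a * x)\<close> does not contain \<open>x\<close>, and the ideal
  generated by \<open>P\<close> and \<open>x\<close> misses the set of the \<open>s\<close>, which belongs to the tail of the list; so
  each entry of the list leaves room for one more prime above the previous ones.
\<close>

fun iterated_boundary :: "('r, 's) ring_scheme \<Rightarrow> 'r list \<Rightarrow> 'r set" where
  "iterated_boundary R [] = {\<one>\<^bsub>R\<^esub>}"
| "iterated_boundary R (x # xs) =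
     {x [^]\<^bsub>R\<^esub> (m::nat) \<otimes>\<^bsub>R\<^esub> (s \<oplus>\<^bsub>R\<^esub> a \<otimes>\<^bsub>R\<^esub> x) | m s a.
        s \<in> iterated_boundary R xs \<and> a \<in> carrier R}"

context cring begin

lemma iterated_boundary_submonoid:
  assumes "set xs \<subseteq> carrier R"
  shows "iterated_boundary R xs \<subseteq> carrier R \<and> \<one> \<in> iterated_boundary R xs \<and>
    (\<forall>s\<in>iterated_boundary R xs. \<forall>t\<in>iterated_boundary R xs. s \<otimes> t \<in> iterated_boundary R xs)"
  using assms
proof (induction xs)
  case (Cons x xs)
  then have x: "x \<in> carrier R" and sub: "iterated_boundary R xs \<subseteq> carrier R"
    and one: "\<one> \<in> iterated_boundary R xs"
    and mult: "\<And>s t. s \<in> iterated_boundary R xs \<Longrightarrow> t \<in> iterated_boundary R xs \<Longrightarrow>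
      s \<otimes> t \<in> iterated_boundary R xs"
    by auto
  have "\<one> = x [^] (0::nat) \<otimes> (\<one> \<oplus> \<zero> \<otimes> x)" using x by simp
  then have "\<one> \<in> iterated_boundary R (x # xs)"
    using one by (simp only: iterated_boundary.simps) blast
  moreover have "p \<otimes> q \<in> iterated_boundary R (x # xs)"
    if p: "p \<in> iterated_boundary R (x # xs)" and q: "q \<in> iterated_boundary R (x # xs)" for p q
  proof -
    obtain m s a where p': "p = x [^] (m::nat) \<otimes> (s \<oplus> a \<otimes> x)" "s \<in> iterated_boundary R xs"
      "a \<in> carrier R" using p by auto
    obtain n t b where q': "q = x [^] (n::nat) \<otimes> (t \<oplus> b \<otimes> x)" "t \<in> iterated_boundary R xs"
      "b \<in> carrier R" using q by auto
    have st: "s \<in> carrier R" "t \<in> carrier R" using p' q' sub by auto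
    have pw: "x [^] m \<in> carrier R" "x [^] n \<in> carrier R" using x by auto
    have "p \<otimes> q = (x [^] m \<otimes> x [^] n) \<otimes> (s \<otimes> t \<oplus> (s \<otimes> b \<oplus> a \<otimes> t \<oplus> a \<otimes> x \<otimes> b) \<otimes> x)"
      unfolding p'(1) q'(1) using st pw p'(3) q'(3) x by algebra
    also have "x [^] m \<otimes> x [^] n = x [^] (m + n)" using x by (simp add: nat_pow_mult)
    finally have "p \<otimes> q = x [^] (m + n) \<otimes> (s \<otimes> t \<oplus> (s \<otimes> b \<oplus> a \<otimes> t \<oplus> a \<otimes> x \<otimes> b) \<otimes> x)" .
    moreover have "s \<otimes> b \<oplus> a \<otimes> t \<oplus> a \<otimes> x \<otimes> b \<in> carrier R" using st p' q' x by simp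
    ultimately show ?thesis using mult[OF p'(2) q'(2)] by (simp only: iterated_boundary.simps) blast
  qed
  moreover have "iterated_boundary R (x # xs) \<subseteq> carrier R" using x sub by auto
  ultimately show ?case by blast
qed simp

text \<open>
  The head \<open>x\<close> of the list lies outside a prime \<open>P\<close> that avoids the whole boundary set, while the ideal
  generated by \<open>P\<close> and \<open>x\<close> still avoids the boundary set of the tail. The induction hypothesis for
  this ideal provides the rest of the chain, which is strictly above \<open>P\<close> because it contains \<open>x\<close>.
\<close>

lemma prime_chain_of_iterated_boundary:
  assumes "ideal I R" "set xs \<subseteq> carrier R" "I \<inter> iterated_boundary R xs = {}"
  shows "\<exists>P. (\<forall>i\<le>length xs. primeideal (P i) R) \<and> (\<forall>i<length xs. P i \<subset> P (Suc i)) \<and> I \<subseteq> P 0"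
  using assms
proof (induction xs arbitrary: I)
  case Nil
  obtain P where "primeideal P R" "I \<subseteq> P" "P \<inter> {\<one>} = {}"
    by (rule prime_ideal_avoiding[OF Nil(1), of "{\<one>}"]) (use Nil(3) in auto)
  then show ?case by (intro exI[of _ "\<lambda>_. P"]) simp
next
  case (Cons x xs)
  have x: "x \<in> carrier R" and xs: "set xs \<subseteq> carrier R" using Cons.prems by auto
  note B = iterated_boundary_submonoid[OF Cons.prems(2)]
  note B' = iterated_boundary_submonoid[OF xs]
  obtain P where P: "primeideal P R" "I \<subseteq> P" "P \<inter> iterated_boundary R (x # xs) = {}"
    by (rule prime_ideal_avoiding[OF Cons.prems(1), of "iterated_boundary R (x # xs)"])
      (use B Cons.prems(3) in auto)
  interpret P: primeideal P R by (rule P)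
  \<comment> \<open>The exponent \<open>1\<close> and the coefficient \<open>\<zero>\<close> show that \<open>x\<close> itself is in the boundary set.\<close>
  have "x = x [^] (1::nat) \<otimes> (\<one> \<oplus> \<zero> \<otimes> x)" using x by simp
  then have "x \<in> iterated_boundary R (x # xs)"
    using B' by (simp only: iterated_boundary.simps) blast
  then have xP: "x \<notin> P" using P(3) by blast
  obtain J where J: "ideal J R" "P \<subseteq> J" "x \<in> J"
    "\<And>y. y \<in> J \<Longrightarrow> \<exists>i\<in>P. \<exists>a\<in>carrier R. y = i \<oplus> a \<otimes> x"
    by (rule add_principal_ideal[OF P.is_ideal x]) blast
  have "J \<inter> iterated_boundary R xs = {}"
  proof (rule ccontr)
    assume "J \<inter> iterated_boundary R xs \<noteq> {}"
    then obtain s where s: "s \<in> J" "s \<in> iterated_boundary R xs" by blast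
    then obtain i a where ia: "i \<in> P" "a \<in> carrier R" "s = i \<oplus> a \<otimes> x" using J(4) by blast
    have i: "i \<in> carrier R" using ia P.a_subset by auto
    \<comment> \<open>Solved for \<open>i\<close>, this is an element of the boundary set with exponent \<open>0\<close>.\<close>
    have "i = s \<oplus> (\<ominus> a) \<otimes> x" unfolding ia(3) using i ia(2) x by algebra
    also have "\<dots> = x [^] (0::nat) \<otimes> (s \<oplus> (\<ominus> a) \<otimes> x)"
      using i x ia by simp
    finally have "i \<in> iterated_boundary R (x # xs)"
      using s(2) a_inv_closed[OF ia(2)] by (simp only: iterated_boundary.simps) blast
    then show False using ia(1) P(3) by blast
  qed
  from Cons.IH[OF J(1) xs this] obtain Q where
    Q: "\<And>i. i \<le> length xs \<Longrightarrow> primeideal (Q i) R" "\<And>i. i < length xs \<Longrightarrow> Q i \<subset> Q (Suc i)"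
      "J \<subseteq> Q 0" by blast
  let ?P = "case_nat P Q"
  have "primeideal (?P i) R" if "i \<le> length (x # xs)" for i
    using that P(1) Q(1) by (cases i) auto
  moreover have "?P i \<subset> ?P (Suc i)" if "i < length (x # xs)" for i
    using that Q(2,3) J(2,3) xP by (cases i) auto
  ultimately show ?case using P(2) by (intro exI[of _ ?P]) simp
qed

end

lemma iterated_boundary_lift:
  assumes "ring_hom_ring R Q h" and surj: "h ` carrier R = carrier Q"
    and "set xs \<subseteq> carrier R" and "s \<in> iterated_boundary Q (map h xs)"
  shows "\<exists>r\<in>iterated_boundary R xs. r \<in> carrier R \<and> h r = s"
  using assms(3,4)
proof (induction xs arbitrary: s)
  interpret ring_hom_ring R Q h by (rule assms(1))
  {
    case Nil
    then show ?case by simp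
  next
    case (Cons x xs)
    then obtain m t b where s: "s = h x [^]\<^bsub>Q\<^esub> (m::nat) \<otimes>\<^bsub>Q\<^esub> (t \<oplus>\<^bsub>Q\<^esub> b \<otimes>\<^bsub>Q\<^esub> h x)"
      "t \<in> iterated_boundary Q (map h xs)" "b \<in> carrier Q" by auto
    obtain r where r: "r \<in> iterated_boundary R xs" "r \<in> carrier R" "h r = t"
      using Cons.IH[OF _ s(2)] Cons.prems by auto
    have "b \<in> h ` carrier R" using s(3) by (simp only: surj)
    then obtain a where a: "a \<in> carrier R" "h a = b" by (elim imageE) simp
    have x: "x \<in> carrier R" using Cons.prems by simp
    let ?r = "x [^]\<^bsub>R\<^esub> m \<otimes>\<^bsub>R\<^esub> (r \<oplus>\<^bsub>R\<^esub> a \<otimes>\<^bsub>R\<^esub> x)"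
    have "?r \<in> iterated_boundary R (x # xs)" using r(1) a(1) by auto
    moreover have "?r \<in> carrier R" using x r a by simp
    moreover have "h ?r = s"
      using x r a by (simp add: s(1) hom_nat_pow)
    ultimately show ?case by blast
  }
qed

text \<open>
  A bound on the Krull dimension of the quotient becomes an identity between elements of the ring
  itself, modulo the ideal: an element of the boundary set of the quotient lifts coefficient by
  coefficient.
\<close>

lemma (in ideal) iterated_boundary_meets_ideal:
  assumes R: "cring R"
    and no_chain: "\<not> (\<exists>P. (\<forall>i\<le>length xs. primeideal (P i) (R Quot I)) \<and> (\<forall>i<length xs. P i \<subset> P (Suc i)))"
    and xs: "set xs \<subseteq> carrier R"
  shows "\<exists>r\<in>iterated_boundary R xs. r \<in> I"
proof -
  interpret Q: cring "R Quot I" by (rule quotient_is_cring[OF R])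
  interpret h: ring_hom_ring R "R Quot I" "(+>) I" by (rule rcos_ring_hom_ring)
  have surj: "(+>) I ` carrier R = carrier (R Quot I)"
    unfolding FactRing_def A_RCOSETS_def' by auto
  have "set (map ((+>) I) xs) \<subseteq> carrier (R Quot I)" using xs surj by auto
  then have "{\<zero>\<^bsub>R Quot I\<^esub>} \<inter> iterated_boundary (R Quot I) (map ((+>) I) xs) \<noteq> {}"
    using Q.prime_chain_of_iterated_boundary[OF Q.zeroideal] no_chain
    by (metis length_map)
  then have "\<zero>\<^bsub>R Quot I\<^esub> \<in> iterated_boundary (R Quot I) (map ((+>) I) xs)" by blast
  from iterated_boundary_lift[OF h.ring_hom_ring_axioms surj xs this]
  obtain r where r: "r \<in> iterated_boundary R xs" "r \<in> carrier R" "I +> r = \<zero>\<^bsub>R Quot I\<^esub>" by blast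
  have "I +> r = I" using r(3) unfolding FactRing_def by simp
  then have "r \<in> I" using a_rcos_self[OF r(2)] by blast
  then show ?thesis using r by blast
qed

section \<open>Finite modules of functions\<close>

text \<open>
  Linear combinations are compared on \<open>Z\<close> only. Functions on the whole type thus represent
  functions on \<open>Z\<close>, and passing to a subset of \<open>Z\<close> needs no restriction maps.
\<close>

inductive_set fspan :: "'z set \<Rightarrow> ('z \<Rightarrow> real) set \<Rightarrow> ('z \<Rightarrow> real) set" for Z F where
  zero: "(\<And>z. z \<in> Z \<Longrightarrow> f z = 0) \<Longrightarrow> f \<in> fspan Z F"
| step: "g \<in> fspan Z F \<Longrightarrow> h \<in> F \<Longrightarrow> (\<And>z. z \<in> Z \<Longrightarrow> f z = g z + c * h z) \<Longrightarrow> f \<in> fspan Z F"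

inductive_set falg :: "('z \<Rightarrow> real) set \<Rightarrow> ('z \<Rightarrow> real) set" for U where
  const: "(\<lambda>_. c) \<in> falg U"
| gen: "u \<in> U \<Longrightarrow> u \<in> falg U"
| add: "f \<in> falg U \<Longrightarrow> g \<in> falg U \<Longrightarrow> (\<lambda>z. f z + g z) \<in> falg U"
| mult: "f \<in> falg U \<Longrightarrow> g \<in> falg U \<Longrightarrow> (\<lambda>z. f z * g z) \<in> falg U"

definition ftimes :: "('z \<Rightarrow> real) set \<Rightarrow> ('z \<Rightarrow> real) set \<Rightarrow> ('z \<Rightarrow> real) set" where
  "ftimes F G = {\<lambda>z. f z * g z | f g. f \<in> F \<and> g \<in> G}"

lemma ftimesI: "f \<in> F \<Longrightarrow> g \<in> G \<Longrightarrow> (\<lambda>z. f z * g z) \<in> ftimes F G"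
  unfolding ftimes_def by blast

lemma ftimesE:
  assumes "h \<in> ftimes F G"
  obtains f g where "f \<in> F" "g \<in> G" "h = (\<lambda>z. f z * g z)"
  using assms unfolding ftimes_def by blast

lemma ftimes_mono: "F \<subseteq> F' \<Longrightarrow> G \<subseteq> G' \<Longrightarrow> ftimes F G \<subseteq> ftimes F' G'"
  unfolding ftimes_def by blast

lemma ftimes_eq_image: "ftimes F G = (\<lambda>(f, g) z. f z * g z) ` (F \<times> G)"
  unfolding ftimes_def by auto

lemma finite_ftimes: "finite F \<Longrightarrow> finite G \<Longrightarrow> finite (ftimes F G)"
  unfolding ftimes_eq_image by simp

lemma card_ftimes_le: "finite F \<Longrightarrow> finite G \<Longrightarrow> card (ftimes F G) \<le> card F * card G"
  using card_image_le[of "F \<times> G" "\<lambda>(f, g) z. f z * g z"]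
  unfolding ftimes_eq_image by (simp add: card_cartesian_product)

lemma fspan_cong: "f \<in> fspan Z F \<Longrightarrow> (\<And>z. z \<in> Z \<Longrightarrow> f' z = f z) \<Longrightarrow> f' \<in> fspan Z F"
proof (induction rule: fspan.cases)
  case (zero f)
  then show ?case by (intro fspan.zero) auto
next
  case (step g h f c)
  show ?case by (rule fspan.step[OF step(2,3)]) (use step in auto)
qed

lemma fspan_base: "f \<in> F \<Longrightarrow> f \<in> fspan Z F"
  by (rule fspan.step[OF fspan.zero[of Z "\<lambda>_. 0"], where h = f and c = 1]) auto

lemma fspan_add:
  assumes "f \<in> fspan Z F" "g \<in> fspan Z F"
  shows "(\<lambda>z. f z + g z) \<in> fspan Z F"
  using assms(2)
proof induction
  case (zero g)
  then show ?case by (auto intro: fspan_cong[OF assms(1)])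
next
  case (step g h g' c)
  show ?case by (rule fspan.step[OF step(4,2), where c = c]) (use step(3) in auto)
qed

lemma fspan_scale: "f \<in> fspan Z F \<Longrightarrow> (\<lambda>z. c * f z) \<in> fspan Z F"
proof (induction rule: fspan.induct)
  case (zero f)
  then show ?case by (intro fspan.zero) auto
next
  case (step g h f d)
  show ?case by (rule fspan.step[OF step(4,2), where c = "c * d"]) (use step(3) in \<open>auto simp: algebra_simps\<close>)
qed

lemma fspan_sum:
  assumes "\<And>i. i \<in> I \<Longrightarrow> f i \<in> fspan Z F"
  shows "(\<lambda>z. \<Sum>i\<in>I. f i z) \<in> fspan Z F"
  using assms
proof (induction I rule: infinite_finite_induct)
  case (insert i I)
  then show ?case by (auto intro: fspan_add)
qed (auto intro: fspan.zero)

lemma fspan_subset: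
  assumes "F \<subseteq> fspan Z G" shows "fspan Z F \<subseteq> fspan Z G"
proof
  fix f assume "f \<in> fspan Z F"
  then show "f \<in> fspan Z G"
  proof induction
    case (zero f)
    then show ?case by (intro fspan.zero)
  next
    case (step g h f c)
    have h: "h \<in> fspan Z G" using step(2) assms by blast
    show ?case
      by (rule fspan_cong[OF fspan_add[OF step(4) fspan_scale[OF h, of c]]]) (use step(3) in auto)
  qed
qed

lemma fspan_mono: "F \<subseteq> G \<Longrightarrow> fspan Z F \<subseteq> fspan Z G"
  by (intro fspan_subset) (auto intro: fspan_base)

lemma fspan_mult_left:
  assumes "f \<in> fspan Z F" and "\<And>h. h \<in> F \<Longrightarrow> (\<lambda>z. h z * g z) \<in> fspan Z H"
  shows "(\<lambda>z. f z * g z) \<in> fspan Z H"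
  using assms(1)
proof induction
  case (zero f)
  then show ?case by (intro fspan.zero) auto
next
  case (step k h f c)
  show ?case
    by (rule fspan_cong[OF fspan_add[OF step(4) fspan_scale[OF assms(2)[OF step(2)], of c]]])
      (use step(3) in \<open>auto simp: algebra_simps\<close>)
qed

lemma fspan_mult:
  assumes f: "f \<in> fspan Z F" and g: "g \<in> fspan Z G" and FG: "ftimes F G \<subseteq> fspan Z H"
  shows "(\<lambda>z. f z * g z) \<in> fspan Z H"
proof (rule fspan_mult_left[OF f])
  fix h assume h: "h \<in> F"
  have "(\<lambda>z. g z * h z) \<in> fspan Z H"
  proof (rule fspan_mult_left[OF g])
    fix k assume "k \<in> G"
    then have "(\<lambda>z. h z * k z) \<in> fspan Z H" using h FG by (auto intro: ftimesI)
    then show "(\<lambda>z. k z * h z) \<in> fspan Z H" by (simp add: mult.commute)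
  qed
  then show "(\<lambda>z. h z * g z) \<in> fspan Z H" by (simp add: mult.commute)
qed

lemma fspan_pullback:
  assumes "f \<in> fspan Z F" and "\<And>y. y \<in> Y \<Longrightarrow> p y \<in> Z" and "\<And>h. h \<in> F \<Longrightarrow> (\<lambda>y. h (p y)) \<in> G"
  shows "(\<lambda>y. f (p y)) \<in> fspan Y G"
  using assms(1)
proof induction
  case (zero f)
  then show ?case using assms(2) by (intro fspan.zero) auto
next
  case (step g h f c)
  show ?case
    by (rule fspan.step[OF step(4) assms(3)[OF step(2)], where c = c]) (use step(3) assms(2) in auto)
qed

lemma fspan_explicit:
  assumes "f \<in> fspan Z F" "finite F"
  shows "\<exists>a. \<forall>z\<in>Z. f z = (\<Sum>h\<in>F. a h * h z)"
  using assms(1)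
proof induction
  case (zero f)
  then show ?case by (intro exI[of _ "\<lambda>_. 0"]) auto
next
  case (step g h f c)
  then obtain a where a: "\<forall>z\<in>Z. g z = (\<Sum>h\<in>F. a h * h z)" by blast
  have "f z = (\<Sum>k\<in>F. (a k + (if k = h then c else 0)) * k z)" if "z \<in> Z" for z
  proof -
    have "(\<Sum>k\<in>F. (if k = h then c else 0) * k z) = (\<Sum>k\<in>F. if k = h then c * h z else 0)"
      by (rule sum.cong) auto
    also have "\<dots> = c * h z" using step(2) assms(2) by simp
    finally show ?thesis using step(3)[OF that] a that by (simp add: algebra_simps sum.distrib)
  qed
  then show ?case by (intro exI[of _ "\<lambda>k. a k + (if k = h then c else 0)"]) blast
qed

lemma falg_subset: "U \<subseteq> falg V \<Longrightarrow> falg U \<subseteq> falg V"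
proof
  fix f assume UV: "U \<subseteq> falg V" and "f \<in> falg U"
  show "f \<in> falg V" using \<open>f \<in> falg U\<close>
    by induction (use UV in \<open>auto intro: falg.intros\<close>)
qed

lemma falg_mono: "U \<subseteq> V \<Longrightarrow> falg U \<subseteq> falg V"
  by (intro falg_subset) (auto intro: falg.gen)

lemma falg_power: "f \<in> falg U \<Longrightarrow> (\<lambda>z. f z ^ n) \<in> falg U"
  by (induction n) (auto intro: falg.intros)

lemma falg_sum: "(\<And>i. i \<in> I \<Longrightarrow> f i \<in> falg U) \<Longrightarrow> (\<lambda>z. \<Sum>i\<in>I. f i z) \<in> falg U"
  by (induction I rule: infinite_finite_induct) (auto intro: falg.intros)

lemma falg_prod: "(\<And>i. i \<in> I \<Longrightarrow> f i \<in> falg U) \<Longrightarrow> (\<lambda>z. \<Prod>i\<in>I. f i z) \<in> falg U"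
  by (induction I rule: infinite_finite_induct) (auto intro: falg.intros)

lemma falg_scale: "f \<in> falg U \<Longrightarrow> (\<lambda>z. c * f z) \<in> falg U"
  by (rule falg.mult[OF falg.const])

text \<open>
  The module over the algebra \<open>falg U\<close> of polynomials in \<open>U\<close> that is generated by \<open>E\<close>, as a module of
  functions on \<open>Z\<close>.
\<close>

definition fmod :: "'z set \<Rightarrow> ('z \<Rightarrow> real) set \<Rightarrow> ('z \<Rightarrow> real) set \<Rightarrow> ('z \<Rightarrow> real) set" where
  "fmod Z U E = fspan Z (ftimes (falg U) E)"

lemma fmod_base: "e \<in> E \<Longrightarrow> e \<in> fmod Z U E"
  using ftimesI[OF falg.const[of 1 U], of e E] unfolding fmod_def by (auto intro: fspan_base)

lemma fmod_falg_mult: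
  assumes "c \<in> falg U" "f \<in> fmod Z U E" shows "(\<lambda>z. c z * f z) \<in> fmod Z U E"
proof -
  have "(\<lambda>z. f z * c z) \<in> fspan Z (ftimes (falg U) E)"
  proof (rule fspan_mult_left[OF assms(2)[unfolded fmod_def]])
    fix h assume "h \<in> ftimes (falg U) E"
    then obtain d e where "d \<in> falg U" "e \<in> E" "h = (\<lambda>z. d z * e z)" by (rule ftimesE)
    then show "(\<lambda>z. h z * c z) \<in> fspan Z (ftimes (falg U) E)"
      using ftimesI[OF falg.mult[OF assms(1)], of d e E] by (intro fspan_base) (simp add: ac_simps)
  qed
  then show ?thesis unfolding fmod_def by (simp add: mult.commute)
qed

lemma fmod_mult_map:
  assumes "f \<in> fmod Z U E" and "\<And>e. e \<in> E \<Longrightarrow> (\<lambda>z. g z * e z) \<in> fmod Z U E'"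
  shows "(\<lambda>z. g z * f z) \<in> fmod Z U E'"
proof -
  have "(\<lambda>z. f z * g z) \<in> fspan Z (ftimes (falg U) E')"
  proof (rule fspan_mult_left[OF assms(1)[unfolded fmod_def]])
    fix h assume "h \<in> ftimes (falg U) E"
    then obtain d e where "d \<in> falg U" "e \<in> E" "h = (\<lambda>z. d z * e z)" by (rule ftimesE)
    then show "(\<lambda>z. h z * g z) \<in> fspan Z (ftimes (falg U) E')"
      using fmod_falg_mult[of d U _ Z E', OF _ assms(2)[of e]] unfolding fmod_def by (simp add: ac_simps)
  qed
  then show ?thesis unfolding fmod_def by (simp add: mult.commute)
qed

text \<open>
  If \<open>E\<close> is finite and contains \<open>1\<close>, multiplying the module generated by \<open>E\<close> into itself is the
  module-theoretic form of being integral over \<open>falg U\<close>. It makes closure under sums and products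
  immediate.
\<close>

definition multipliers :: "'z set \<Rightarrow> ('z \<Rightarrow> real) set \<Rightarrow> ('z \<Rightarrow> real) set \<Rightarrow> ('z \<Rightarrow> real) set" where
  "multipliers Z U E = {f. \<forall>e\<in>E. (\<lambda>z. f z * e z) \<in> fmod Z U E}"

lemma multipliers_mult:
  assumes "f \<in> multipliers Z U E" "g \<in> multipliers Z U E"
  shows "(\<lambda>z. f z * g z) \<in> multipliers Z U E"
  unfolding multipliers_def
proof safe
  fix e assume "e \<in> E"
  then have "(\<lambda>z. g z * e z) \<in> fmod Z U E" using assms(2) unfolding multipliers_def by blast
  then have "(\<lambda>z. f z * (g z * e z)) \<in> fmod Z U E"
    by (rule fmod_mult_map) (use assms(1) in \<open>auto simp: multipliers_def\<close>)
  then show "(\<lambda>z. f z * g z * e z) \<in> fmod Z U E" by (simp add: mult.assoc)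
qed

lemma multipliers_add:
  assumes "f \<in> multipliers Z U E" "g \<in> multipliers Z U E"
  shows "(\<lambda>z. f z + g z) \<in> multipliers Z U E"
  using assms by (auto simp: multipliers_def fmod_def distrib_right intro: fspan_add)

lemma falg_multipliers: "falg U \<subseteq> multipliers Z U E"
  by (auto simp: multipliers_def intro: fmod_falg_mult fmod_base)

lemma multipliers_power: "f \<in> multipliers Z U E \<Longrightarrow> (\<lambda>z. f z ^ n) \<in> multipliers Z U E"
proof (induction n)
  case 0
  then show ?case using falg_multipliers[of U Z E] falg.const[of 1 U] by auto
qed (auto intro: multipliers_mult)

lemma clear_denominators:
  assumes b: "b \<in> multipliers Z U E" and \<Phi>: "\<And>\<phi>. \<phi> \<in> \<Phi> \<Longrightarrow> (\<lambda>z. b z * \<phi> z) \<in> multipliers Z U E"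
    and "\<psi> \<in> falg \<Phi>"
  shows "\<exists>t::nat. (\<lambda>z. b z ^ t * \<psi> z) \<in> multipliers Z U E"
  using assms(3)
proof induction
  case (const c)
  then show ?case using falg_multipliers[of U Z E] falg.const[of c U] by (intro exI[of _ 0]) auto
next
  case (gen u)
  then show ?case using \<Phi> by (intro exI[of _ 1]) auto
next
  case (add f g)
  then obtain s t where s: "(\<lambda>z. b z ^ s * f z) \<in> multipliers Z U E"
    and t: "(\<lambda>z. b z ^ t * g z) \<in> multipliers Z U E" by blast
  have "(\<lambda>z. b z ^ t * (b z ^ s * f z) + b z ^ s * (b z ^ t * g z)) \<in> multipliers Z U E"
    by (intro multipliers_add multipliers_mult[OF multipliers_power] s t b)
  then show ?case by (intro exI[of _ "s + t"]) (simp add: algebra_simps power_add)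
next
  case (mult f g)
  then obtain s t where s: "(\<lambda>z. b z ^ s * f z) \<in> multipliers Z U E"
    and t: "(\<lambda>z. b z ^ t * g z) \<in> multipliers Z U E" by blast
  show ?case using multipliers_mult[OF s t]
    by (intro exI[of _ "s + t"]) (simp add: algebra_simps power_add)
qed

text \<open>
  The functions in \<open>\<Phi>\<close> are integral over \<open>falg U\<close> once elements of \<open>D\<close> are inverted; the
  denominator \<open>b\<close> is kept explicit instead of passing to a localization. The set \<open>D\<close> is a parameter
  because two kinds of denominators occur: polynomials in \<open>U\<close>, which can be evaluated outside
  \<open>Z\<close>, and arbitrary functions without zeros on \<open>Z\<close>.
\<close>

definition finite_over ::
  "'z set \<Rightarrow> ('z \<Rightarrow> real) set \<Rightarrow> ('z \<Rightarrow> real) set \<Rightarrow> ('z \<Rightarrow> real) set \<Rightarrow> bool" where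
  "finite_over Z U D \<Phi> \<longleftrightarrow> (\<exists>b\<in>D. \<exists>E. finite E \<and> (\<lambda>_. 1) \<in> E \<and> b \<in> multipliers Z U E \<and>
     (\<forall>\<phi>\<in>\<Phi>. (\<lambda>z. b z * \<phi> z) \<in> multipliers Z U E))"

definition denominators :: "('z \<Rightarrow> real) set \<Rightarrow> bool" where
  "denominators D \<longleftrightarrow> (\<lambda>_. 1) \<in> D \<and> (\<forall>f\<in>D. \<forall>g\<in>D. (\<lambda>z. f z * g z) \<in> D)"

lemma denominators_one: "denominators D \<Longrightarrow> (\<lambda>_. 1) \<in> D"
  and denominators_mult: "denominators D \<Longrightarrow> f \<in> D \<Longrightarrow> g \<in> D \<Longrightarrow> (\<lambda>z. f z * g z) \<in> D"
  unfolding denominators_def by auto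

lemma denominators_power: "denominators D \<Longrightarrow> f \<in> D \<Longrightarrow> (\<lambda>z. f z ^ n) \<in> D"
  by (induction n) (auto intro: denominators_one denominators_mult)

lemma finite_over_subset: "finite_over Z U D \<Phi> \<Longrightarrow> \<Psi> \<subseteq> \<Phi> \<Longrightarrow> finite_over Z U D \<Psi>"
  unfolding finite_over_def by blast

lemma finite_over_falg:
  assumes "denominators D" shows "finite_over Z U D (falg U)"
  unfolding finite_over_def
  using falg_multipliers[of U Z "{\<lambda>_. 1}"] falg.const[of 1 U] denominators_one[OF assms]
  by (intro bexI[of _ "\<lambda>_. 1"] exI[of _ "{\<lambda>_. 1}"]) auto

lemma finite_over_insert_falg:
  assumes D: "denominators D" and fin: "finite_over Z U D \<Phi>" and \<psi>: "\<psi> \<in> falg \<Phi>"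
  shows "finite_over Z U D (insert \<psi> \<Phi>)"
proof -
  obtain b E where b: "b \<in> D" "b \<in> multipliers Z U E" and E: "finite E" "(\<lambda>_. 1) \<in> E"
    and \<Phi>: "\<And>\<phi>. \<phi> \<in> \<Phi> \<Longrightarrow> (\<lambda>z. b z * \<phi> z) \<in> multipliers Z U E"
    using fin unfolding finite_over_def by blast
  obtain t where t: "(\<lambda>z. b z ^ t * \<psi> z) \<in> multipliers Z U E"
    using clear_denominators[OF b(2) \<Phi> \<psi>] by blast
  have 1: "(\<lambda>z. b z ^ t * b z) \<in> D" by (intro denominators_mult[OF D] denominators_power D b)
  have 2: "(\<lambda>z. b z ^ t * b z) \<in> multipliers Z U E" by (intro multipliers_mult multipliers_power b)
  have 3: "(\<lambda>z. b z ^ t * b z * \<phi> z) \<in> multipliers Z U E" if "\<phi> \<in> \<Phi>" for \<phi>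
    using multipliers_mult[OF multipliers_power[OF b(2), of t] \<Phi>[OF that]] by (simp add: ac_simps)
  have 4: "(\<lambda>z. b z ^ t * b z * \<psi> z) \<in> multipliers Z U E"
    using multipliers_mult[OF b(2) t] by (simp add: ac_simps)
  show ?thesis unfolding finite_over_def using 1 2 3 4 E by blast
qed

lemma finite_over_Un_falg:
  assumes D: "denominators D" and fin: "finite_over Z U D \<Phi>" and "finite \<Psi>" "\<Psi> \<subseteq> falg \<Phi>"
  shows "finite_over Z U D (\<Psi> \<union> \<Phi>)"
  using assms(3,4)
proof (induction \<Psi>)
  case (insert \<psi> \<Psi>)
  have "\<psi> \<in> falg (\<Psi> \<union> \<Phi>)" using insert.prems falg_mono[of \<Phi> "\<Psi> \<union> \<Phi>"] by blast
  then show ?case using finite_over_insert_falg[OF D, of Z U "\<Psi> \<union> \<Phi>" \<psi>] insert by auto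
qed (use fin in simp)

text \<open>
  The old generators multiplied by \<open>f ^ i\<close> for \<open>i < n\<close> generate a module that is stable under \<open>f\<close>, up
  to the denominator \<open>a n\<close>: the equation expresses \<open>a n * f ^ n\<close> by lower powers.
\<close>

lemma finite_over_adjoin_root:
  assumes D: "denominators D" and fin: "finite_over Z U D \<Phi>"
    and a: "\<And>i. i \<le> n \<Longrightarrow> a i \<in> \<Phi>" and n: "0 < n" and lead: "a n \<in> D"
    and root: "\<And>z. z \<in> Z \<Longrightarrow> (\<Sum>i\<le>n. a i z * f z ^ i) = 0"
  shows "finite_over Z U D (insert f \<Phi>)"
proof -
  obtain b E where b: "b \<in> D" "b \<in> multipliers Z U E" and E: "finite E" "(\<lambda>_. 1) \<in> E"
    and \<Phi>: "\<And>\<phi>. \<phi> \<in> \<Phi> \<Longrightarrow> (\<lambda>z. b z * \<phi> z) \<in> multipliers Z U E"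
    using fin unfolding finite_over_def by blast
  define E' where "E' = ftimes ((\<lambda>i z. f z ^ i) ` {..<n}) E"
  have E'I: "(\<lambda>z. f z ^ i * e z) \<in> E'" if "i < n" "e \<in> E" for i e
    using that ftimesI[of "\<lambda>z. f z ^ i" "(\<lambda>i z. f z ^ i) ` {..<n}" e E] unfolding E'_def by blast
  have E'E: "\<exists>i<n. \<exists>e\<in>E. g = (\<lambda>z. f z ^ i * e z)" if "g \<in> E'" for g
    using that unfolding E'_def ftimes_def by blast
  have up: "(\<lambda>z. f z ^ i * g z) \<in> fmod Z U E'" if "i < n" "g \<in> fmod Z U E" for i g
    using that by (intro fmod_mult_map[OF that(2)] fmod_base E'I)
  have sub: "g \<in> multipliers Z U E'" if g: "g \<in> multipliers Z U E" for g
    unfolding multipliers_def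
  proof safe
    fix h assume "h \<in> E'"
    then obtain i e where h: "i < n" "e \<in> E" "h = (\<lambda>z. f z ^ i * e z)" using E'E by blast
    have "(\<lambda>z. g z * e z) \<in> fmod Z U E" using g h(2) unfolding multipliers_def by blast
    from up[OF h(1) this] show "(\<lambda>z. g z * h z) \<in> fmod Z U E'" unfolding h(3) by (simp add: ac_simps)
  qed
  have ba: "(\<lambda>z. b z * a i z) \<in> multipliers Z U E" if "i \<le> n" for i
    using \<Phi>[OF a[OF that]] .
  have f: "(\<lambda>z. b z * a n z * f z) \<in> multipliers Z U E'"
    unfolding multipliers_def
  proof safe
    fix h assume "h \<in> E'"
    then obtain i e where h: "i < n" "e \<in> E" "h = (\<lambda>z. f z ^ i * e z)" using E'E by blast
    have be: "(\<lambda>z. b z * a j z * e z) \<in> fmod Z U E" if "j \<le> n" for j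
      using ba[OF that] h(2) unfolding multipliers_def by blast
    show "(\<lambda>z. b z * a n z * f z * h z) \<in> fmod Z U E'"
    proof (cases "Suc i < n")
      case True
      from up[OF True be[of n]] show ?thesis unfolding h(3) by (simp add: ac_simps)
    next
      case False
      then have i: "n = Suc i" using h(1) by simp
      \<comment> \<open>Here the equation rewrites the top power \<open>f ^ n\<close> by the lower ones.\<close>
      have S: "(\<lambda>z. \<Sum>j<n. - 1 * (f z ^ j * (b z * a j z * e z))) \<in> fmod Z U E'"
        unfolding fmod_def
        by (intro fspan_sum fspan_scale) (use up be in \<open>auto simp: fmod_def\<close>)
      show ?thesis unfolding fmod_def
      proof (rule fspan_cong[OF S[unfolded fmod_def]])
        fix z assume "z \<in> Z"
        then have "a n z * f z ^ n = - (\<Sum>j<n. a j z * f z ^ j)"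
          using root[of z] by (simp add: lessThan_Suc_atMost[symmetric])
        then have "b z * a n z * f z * h z = b z * e z * - (\<Sum>j<n. a j z * f z ^ j)"
          unfolding h(3) by (simp add: i ac_simps)
        also have "\<dots> = (\<Sum>j<n. - 1 * (f z ^ j * (b z * a j z * e z)))"
          by (simp add: sum_distrib_left sum_negf ac_simps)
        finally show "b z * a n z * f z * h z = (\<Sum>j<n. - 1 * (f z ^ j * (b z * a j z * e z)))" .
      qed
    qed
  qed
  let ?b = "\<lambda>z. b z * (b z * a n z)"
  have "?b \<in> D" by (intro denominators_mult[OF D] b lead)
  moreover have "finite E'" unfolding E'_def using E by (intro finite_ftimes) auto
  moreover have "(\<lambda>_. 1) \<in> E'" using E'I[OF n E(2)] by simp
  moreover have "?b \<in> multipliers Z U E'" by (intro multipliers_mult sub b ba order_refl)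
  moreover have "(\<lambda>z. ?b z * \<phi> z) \<in> multipliers Z U E'" if "\<phi> \<in> insert f \<Phi>" for \<phi>
  proof (cases "\<phi> = f")
    case True
    then show ?thesis using multipliers_mult[OF sub[OF b(2)] f] by (simp add: ac_simps)
  next
    case False
    then have "(\<lambda>z. b z * \<phi> z) \<in> multipliers Z U E" using that \<Phi> by blast
    from multipliers_mult[OF this ba[of n]] show ?thesis by (intro sub) (simp add: ac_simps)
  qed
  ultimately show ?thesis unfolding finite_over_def by blast
qed

definition algebraic_over ::
  "'z set \<Rightarrow> ('z \<Rightarrow> real) set \<Rightarrow> ('z \<Rightarrow> real) set \<Rightarrow> ('z \<Rightarrow> real) \<Rightarrow> bool" where
  "algebraic_over Z D \<Phi> f \<longleftrightarrow> (\<exists>n>0. \<exists>a. (\<forall>i\<le>n. a i \<in> falg \<Phi>) \<and> a n \<in> D \<and>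
     (\<forall>z\<in>Z. (\<Sum>i\<le>n. a i z * f z ^ i) = 0))"

lemma finite_over_adjoin_algebraic:
  assumes D: "denominators D" and fin: "finite_over Z U D \<Phi>"
    and "finite F" and "\<And>f. f \<in> F \<Longrightarrow> algebraic_over Z D \<Phi> f"
  shows "finite_over Z U D (F \<union> \<Phi>)"
  using assms(3,4)
proof (induction F)
  case (insert f F)
  then have F: "finite_over Z U D (F \<union> \<Phi>)" by simp
  from insert.prems have "algebraic_over Z D \<Phi> f" by simp
  then obtain n a where n: "n > 0" and a: "\<And>i. i \<le> n \<Longrightarrow> a i \<in> falg \<Phi>" "a n \<in> D"
    and root: "\<And>z. z \<in> Z \<Longrightarrow> (\<Sum>i\<le>n. a i z * f z ^ i) = 0"
    unfolding algebraic_over_def by blast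
  have "a ` {..n} \<subseteq> falg (F \<union> \<Phi>)" using a(1) falg_mono[of \<Phi> "F \<union> \<Phi>"] by blast
  from finite_over_Un_falg[OF D F _ this]
  have "finite_over Z U D (a ` {..n} \<union> (F \<union> \<Phi>))" by simp
  from finite_over_adjoin_root[OF D this _ n a(2) root]
  have "finite_over Z U D (insert f (a ` {..n} \<union> (F \<union> \<Phi>)))" by auto
  then show ?case by (rule finite_over_subset) auto
qed (use fin in simp)

lemma finite_over_pullback:
  assumes fin: "finite_over Z U D \<Phi>" and p: "\<And>y. y \<in> Y \<Longrightarrow> p y \<in> Z"
    and U: "\<And>u. u \<in> U \<Longrightarrow> (\<lambda>y. u (p y)) \<in> V" and D: "\<And>b. b \<in> D \<Longrightarrow> (\<lambda>y. b (p y)) \<in> D'"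
  shows "finite_over Y V D' ((\<lambda>\<phi> y. \<phi> (p y)) ` \<Phi>)"
proof -
  obtain b E where b: "b \<in> D" "b \<in> multipliers Z U E" and E: "finite E" "(\<lambda>_. 1) \<in> E"
    and \<Phi>: "\<And>\<phi>. \<phi> \<in> \<Phi> \<Longrightarrow> (\<lambda>z. b z * \<phi> z) \<in> multipliers Z U E"
    using fin unfolding finite_over_def by blast
  let ?E = "(\<lambda>\<phi> y. \<phi> (p y)) ` E"
  have alg: "(\<lambda>y. f (p y)) \<in> falg V" if "f \<in> falg U" for f
    using that by induction (auto intro: falg.intros U)
  have mod: "(\<lambda>y. f (p y)) \<in> fmod Y V ?E" if "f \<in> fmod Z U E" for f
    using that[unfolded fmod_def] p unfolding fmod_def
  proof (rule fspan_pullback)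
    fix h assume "h \<in> ftimes (falg U) E"
    then obtain d e where "d \<in> falg U" "e \<in> E" "h = (\<lambda>z. d z * e z)" by (rule ftimesE)
    then show "(\<lambda>y. h (p y)) \<in> ftimes (falg V) ?E"
      using ftimesI[OF alg, of d "\<lambda>y. e (p y)" ?E] by auto
  qed
  have mul: "(\<lambda>y. f (p y)) \<in> multipliers Y V ?E" if "f \<in> multipliers Z U E" for f
    using that mod unfolding multipliers_def by auto
  have "(\<lambda>_. 1) \<in> ?E" using E(2) by (auto simp: image_iff intro!: bexI[of _ "\<lambda>_. 1"])
  then show ?thesis unfolding finite_over_def
    using D[OF b(1)] mul[OF b(2)] mul[OF \<Phi>] E(1)
    by (intro bexI[of _ "\<lambda>y. b (p y)"] exI[of _ ?E]) auto
qed

lemma multipliers_ftimes: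
  assumes "f \<in> multipliers Z U E"
  shows "f \<in> multipliers Z U (ftimes E E')"
  unfolding multipliers_def
proof safe
  fix h assume "h \<in> ftimes E E'"
  then obtain e e' where h: "e \<in> E" "e' \<in> E'" "h = (\<lambda>z. e z * e' z)" by (rule ftimesE)
  have fe: "(\<lambda>z. f z * e z) \<in> fmod Z U E" using assms h(1) unfolding multipliers_def by blast
  have "(\<lambda>z. e' z * (f z * e z)) \<in> fmod Z U (ftimes E E')"
    by (rule fmod_mult_map[OF fe]) (use h(2) ftimesI[of _ E e' E'] in \<open>auto simp: mult.commute intro!: fmod_base\<close>)
  then show "(\<lambda>z. f z * h z) \<in> fmod Z U (ftimes E E')" unfolding h(3) by (simp add: ac_simps)
qed

lemma ftimes_commute: "ftimes E E' = ftimes E' E"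
proof -
  have "ftimes A B \<subseteq> ftimes B A" for A B :: "('a \<Rightarrow> real) set"
  proof
    fix h assume "h \<in> ftimes A B"
    then obtain f g where "f \<in> A" "g \<in> B" "h = (\<lambda>z. f z * g z)" by (rule ftimesE)
    then show "h \<in> ftimes B A" using ftimesI[of g B f A] by (simp add: mult.commute)
  qed
  then show ?thesis by blast
qed

lemma finite_over_Un:
  assumes D: "denominators D" and fin: "finite_over Z U D \<Phi>" "finite_over Z U D \<Psi>"
  shows "finite_over Z U D (\<Phi> \<union> \<Psi>)"
proof -
  obtain b E where b: "b \<in> D" "b \<in> multipliers Z U E" and E: "finite E" "(\<lambda>_. 1) \<in> E"
    and \<Phi>: "\<And>\<phi>. \<phi> \<in> \<Phi> \<Longrightarrow> (\<lambda>z. b z * \<phi> z) \<in> multipliers Z U E"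
    using fin(1) unfolding finite_over_def by blast
  obtain c F where c: "c \<in> D" "c \<in> multipliers Z U F" and F: "finite F" "(\<lambda>_. 1) \<in> F"
    and \<Psi>: "\<And>\<phi>. \<phi> \<in> \<Psi> \<Longrightarrow> (\<lambda>z. c z * \<phi> z) \<in> multipliers Z U F"
    using fin(2) unfolding finite_over_def by blast
  let ?G = "ftimes E F" and ?d = "\<lambda>z. b z * c z"
  note L = multipliers_ftimes[of _ Z U E F] and R = multipliers_ftimes[of _ Z U F E, unfolded ftimes_commute[of F E]]
  have "?d \<in> D" by (intro denominators_mult[OF D] b c)
  moreover have "finite ?G" using E F by (intro finite_ftimes)
  moreover have "(\<lambda>_. 1) \<in> ?G" using ftimesI[OF E(2) F(2)] by simp
  moreover have "?d \<in> multipliers Z U ?G" by (intro multipliers_mult L R b c)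
  moreover have "(\<lambda>z. ?d z * \<phi> z) \<in> multipliers Z U ?G" if "\<phi> \<in> \<Phi> \<union> \<Psi>" for \<phi>
    using that
  proof
    assume "\<phi> \<in> \<Phi>"
    from multipliers_mult[OF L[OF \<Phi>[OF this]] R[OF c(2)]] show ?thesis by (simp add: ac_simps)
  next
    assume "\<phi> \<in> \<Psi>"
    from multipliers_mult[OF L[OF b(2)] R[OF \<Psi>[OF this]]] show ?thesis by (simp add: ac_simps)
  qed
  ultimately show ?thesis unfolding finite_over_def by blast
qed

section \<open>Algebraic dependence by counting monomials\<close>

text \<open>
  The exponents are bounded separately, which makes the number of monomials at most
  \<open>(N + 1) ^ card U\<close> and needs no total degree.
\<close>

definition monomials :: "('z \<Rightarrow> real) set \<Rightarrow> nat \<Rightarrow> ('z \<Rightarrow> real) set" where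
  "monomials U N = (\<lambda>\<beta> z. \<Prod>u\<in>U. u z ^ \<beta> u) ` (U \<rightarrow>\<^sub>E {..N})"

lemma monomialsI: 
  assumes "\<And>u. u \<in> U \<Longrightarrow> \<beta> u \<le> N" shows "(\<lambda>z. \<Prod>u\<in>U. u z ^ \<beta> u) \<in> monomials U N"
proof -
  have "(\<lambda>z. \<Prod>u\<in>U. u z ^ \<beta> u) = (\<lambda>z. \<Prod>u\<in>U. u z ^ restrict \<beta> U u)" by auto
  moreover have "restrict \<beta> U \<in> U \<rightarrow>\<^sub>E {..N}" using assms by auto
  ultimately show ?thesis unfolding monomials_def by blast
qed

lemma monomialsE:
  assumes "f \<in> monomials U N"
  obtains \<beta> where "\<And>u. u \<in> U \<Longrightarrow> \<beta> u \<le> N" "f = (\<lambda>z. \<Prod>u\<in>U. u z ^ \<beta> u)"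
proof -
  obtain \<beta> where "\<beta> \<in> U \<rightarrow>\<^sub>E {..N}" "f = (\<lambda>z. \<Prod>u\<in>U. u z ^ \<beta> u)"
    using assms unfolding monomials_def by blast
  then show thesis by (intro that[of \<beta>]) auto
qed

lemma monomials_mono: "M \<le> N \<Longrightarrow> monomials U M \<subseteq> monomials U N"
  unfolding monomials_def by (intro image_mono PiE_mono) auto

lemma monomials_mult:
  assumes "f \<in> monomials U M" "g \<in> monomials U N"
  shows "(\<lambda>z. f z * g z) \<in> monomials U (M + N)"
proof -
  obtain \<beta> \<gamma> where *: "\<And>u. u \<in> U \<Longrightarrow> \<beta> u \<le> M" "f = (\<lambda>z. \<Prod>u\<in>U. u z ^ \<beta> u)"
    "\<And>u. u \<in> U \<Longrightarrow> \<gamma> u \<le> N" "g = (\<lambda>z. \<Prod>u\<in>U. u z ^ \<gamma> u)"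
    using assms by (elim monomialsE) blast
  have "(\<lambda>z. f z * g z) = (\<lambda>z. \<Prod>u\<in>U. u z ^ (\<beta> u + \<gamma> u))"
    by (simp add: *(2,4) power_add prod.distrib)
  then show ?thesis using *(1,3) monomialsI[of U "\<lambda>u. \<beta> u + \<gamma> u" "M + N"] by (simp add: add_mono)
qed

lemma finite_monomials: "finite U \<Longrightarrow> finite (monomials U N)"
  unfolding monomials_def by (intro finite_imageI finite_PiE) auto

lemma card_monomials_le: "finite U \<Longrightarrow> card (monomials U N) \<le> Suc N ^ card U"
  unfolding monomials_def
  by (rule order_trans[OF card_image_le]) (auto simp: card_PiE finite_PiE)

lemma falg_bounded_degree:
  assumes U: "finite U" and f: "f \<in> falg U"
  shows "\<exists>N. f \<in> fspan UNIV (monomials U N)"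
  using f
proof induction
  case (const c)
  have "(\<lambda>z. 1) \<in> monomials U 0" using monomialsI[of U "\<lambda>_. 0" 0] by simp
  from fspan_scale[OF fspan_base[OF this, of UNIV], of c] show ?case by auto
next
  case (gen u)
  have "(\<lambda>z. \<Prod>v\<in>U. v z ^ (if v = u then 1 else 0)) \<in> monomials U 1" by (rule monomialsI) auto
  moreover have "(\<lambda>z. \<Prod>v\<in>U. v z ^ (if v = u then 1 else 0)) = u"
  proof
    fix z
    have "(\<Prod>v\<in>U. v z ^ (if v = u then 1 else 0)) = (\<Prod>v\<in>U. if v = u then u z else 1)"
      by (rule prod.cong) auto
    then show "(\<Prod>v\<in>U. v z ^ (if v = u then 1 else 0)) = u z" using U gen by simp
  qed
  ultimately show ?case by (metis fspan_base)
next
  case (add f g)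
  then obtain M N where "f \<in> fspan UNIV (monomials U M)" "g \<in> fspan UNIV (monomials U N)" by blast
  then have "f \<in> fspan UNIV (monomials U (M + N))" "g \<in> fspan UNIV (monomials U (M + N))"
    using fspan_mono[OF monomials_mono[of M "M + N"]] fspan_mono[OF monomials_mono[of N "M + N"]]
    by (meson le_add1 le_add2 subsetD)+
  then show ?case by (blast intro: fspan_add)
next
  case (mult f g)
  then obtain M N where fg: "f \<in> fspan UNIV (monomials U M)" "g \<in> fspan UNIV (monomials U N)" by blast
  have "ftimes (monomials U M) (monomials U N) \<subseteq> fspan UNIV (monomials U (M + N))"
    by (auto elim!: ftimesE intro!: fspan_base monomials_mult)
  from fspan_mult[OF fg this] show ?case by blast
qed

lemma fspan_restrict: "f \<in> fspan UNIV F \<Longrightarrow> f \<in> fspan Z F"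
  using fspan_pullback[of f UNIV F Z "\<lambda>z. z" F] by simp

lemma fmod_bounded_degree:
  assumes U: "finite U" and f: "f \<in> fmod Z U E"
  shows "\<exists>N. f \<in> fspan Z (ftimes (monomials U N) E)"
  using f[unfolded fmod_def]
proof induction
  case (zero f)
  then show ?case by (blast intro: fspan.zero)
next
  case (step g h f c)
  obtain M where M: "g \<in> fspan Z (ftimes (monomials U M) E)" using step by blast
  obtain d e where h: "d \<in> falg U" "e \<in> E" "h = (\<lambda>z. d z * e z)" using step(2) by (rule ftimesE)
  obtain N where "d \<in> fspan UNIV (monomials U N)" using falg_bounded_degree[OF U h(1)] by blast
  then have d: "d \<in> fspan Z (monomials U N)" by (rule fspan_restrict)
  have mono: "fspan Z (ftimes (monomials U K) E) \<subseteq> fspan Z (ftimes (monomials U (M + N)) E)"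
    if "K \<le> M + N" for K
    by (intro fspan_mono ftimes_mono monomials_mono that order_refl)
  have "h \<in> fspan Z (ftimes (monomials U N) E)"
    unfolding h(3) by (rule fspan_mult_left[OF d]) (intro fspan_base ftimesI h(2))
  then have h': "h \<in> fspan Z (ftimes (monomials U (M + N)) E)" using mono[of N] by auto
  have g': "g \<in> fspan Z (ftimes (monomials U (M + N)) E)" using mono[of M] M by auto
  have "f \<in> fspan Z (ftimes (monomials U (M + N)) E)"
    by (rule fspan_cong[OF fspan_add[OF g' fspan_scale[OF h', of c]]]) (use step(3) in auto)
  then show ?case by blast
qed

lemma homogeneous_system_solution:
  fixes a :: "nat \<Rightarrow> 'h \<Rightarrow> real"
  assumes "finite F" "card F < n"
  shows "\<exists>c. (\<exists>m<n. c m \<noteq> 0) \<and> (\<forall>h\<in>F. (\<Sum>m<n. c m * a m h) = 0)"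
  using assms
proof (induction F arbitrary: n a)
  case empty
  then show ?case by (intro exI[of _ "\<lambda>_. 1"]) auto
next
  case (insert h F)
  then obtain n' where n: "n = Suc n'" by (cases n) auto
  show ?case
  proof (cases "\<exists>p<n. a p h \<noteq> 0")
    case False
    with insert.IH[of n a] insert.prems insert.hyps show ?thesis by auto
  next
    case True
    then obtain p where p: "p < n" "a p h \<noteq> 0" by blast
    \<comment> \<open>Eliminate the unknown \<open>p\<close>: \<open>\<sigma>\<close> enumerates the other unknowns.\<close>
    define \<sigma> where "\<sigma> m = (if m < p then m else Suc m)" for m
    have bij: "bij_betw \<sigma> {..<n'} ({..<n} - {p})"
    proof (rule bij_betwI[where g = "\<lambda>m. if m < p then m else m - 1"])
      show "\<sigma> \<in> {..<n'} \<rightarrow> {..<n} - {p}" using p n by (auto simp: \<sigma>_def)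
    qed (use p n in \<open>auto simp: \<sigma>_def split: if_splits\<close>)
    define b where "b m k = a (\<sigma> m) k - a (\<sigma> m) h / a p h * a p k" for m k
    obtain c where c: "\<exists>m<n'. c m \<noteq> 0" "\<And>k. k \<in> F \<Longrightarrow> (\<Sum>m<n'. c m * b m k) = 0"
      using insert.IH[of n' b] insert.prems insert.hyps n by auto
    define d where "d m = c (the_inv_into {..<n'} \<sigma> m)" for m
    have d\<sigma>: "d (\<sigma> m) = c m" if "m < n'" for m
      using the_inv_into_f_f[OF bij_betw_imp_inj_on[OF bij]] that by (simp add: d_def)
    define s where "s = (\<Sum>m<n'. c m * a (\<sigma> m) h)"
    define e where "e m = (if m = p then - s / a p h else d m)" for m
    have sum: "(\<Sum>m<n. e m * a m k) = - s / a p h * a p k + (\<Sum>m<n'. c m * a (\<sigma> m) k)" for k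
    proof -
      have "(\<Sum>m<n. e m * a m k) = e p * a p k + (\<Sum>m\<in>{..<n} - {p}. e m * a m k)"
        using p by (simp add: sum.remove)
      also have "(\<Sum>m\<in>{..<n} - {p}. e m * a m k) = (\<Sum>m<n'. e (\<sigma> m) * a (\<sigma> m) k)"
        by (rule sum.reindex_bij_betw[OF bij, symmetric])
      also have "\<dots> = (\<Sum>m<n'. c m * a (\<sigma> m) k)"
      proof (rule sum.cong)
        fix m assume "m \<in> {..<n'}"
        moreover have "\<sigma> m \<noteq> p" by (simp add: \<sigma>_def)
        ultimately show "e (\<sigma> m) * a (\<sigma> m) k = c m * a (\<sigma> m) k" by (simp add: e_def d\<sigma>)
      qed simp
      finally show ?thesis by (simp add: e_def)
    qed
    have "\<exists>m<n. e m \<noteq> 0"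
    proof -
      obtain m where m: "m < n'" "c m \<noteq> 0" using c(1) by blast
      have "\<sigma> m < n" "\<sigma> m \<noteq> p" using m n by (auto simp: \<sigma>_def)
      then show ?thesis using m d\<sigma> by (intro exI[of _ "\<sigma> m"]) (simp add: e_def)
    qed
    moreover have "(\<Sum>m<n. e m * a m k) = 0" if "k \<in> insert h F" for k
    proof (cases "k = h")
      case True
      then show ?thesis using p by (simp add: sum s_def)
    next
      case False
      then have "(\<Sum>m<n'. c m * b m k) = 0" using that c(2) by blast
      moreover have "(\<Sum>m<n'. c m * b m k) = (\<Sum>m<n'. c m * a (\<sigma> m) k) - s / a p h * a p k"
        by (simp add: b_def s_def algebra_simps sum_subtractf sum_distrib_left sum_divide_distrib)
      ultimately show ?thesis by (simp add: sum)
    qed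
    ultimately show ?thesis by blast
  qed
qed

lemma fspan_dependent:
  assumes "finite F" "card F < n" and "\<And>m. m < n \<Longrightarrow> \<psi> m \<in> fspan Z F"
  shows "\<exists>c. (\<exists>m<n. c m \<noteq> 0) \<and> (\<forall>z\<in>Z. (\<Sum>m<n. c m * \<psi> m z) = 0)"
proof -
  have "\<forall>m. \<exists>a. m < n \<longrightarrow> (\<forall>z\<in>Z. \<psi> m z = (\<Sum>h\<in>F. a h * h z))"
    using fspan_explicit[OF assms(3,1)] by blast
  then obtain a where a: "\<And>m z. m < n \<Longrightarrow> z \<in> Z \<Longrightarrow> \<psi> m z = (\<Sum>h\<in>F. a m h * h z)" by metis
  obtain c where c: "\<exists>m<n. c m \<noteq> 0" "\<And>h. h \<in> F \<Longrightarrow> (\<Sum>m<n. c m * a m h) = 0"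
    using homogeneous_system_solution[OF assms(1,2), of a] by blast
  have "(\<Sum>m<n. c m * \<psi> m z) = 0" if "z \<in> Z" for z
  proof -
    have "(\<Sum>m<n. c m * \<psi> m z) = (\<Sum>m<n. \<Sum>h\<in>F. c m * a m h * h z)"
      by (rule sum.cong) (auto simp: a that sum_distrib_left mult.assoc)
    also have "\<dots> = (\<Sum>h\<in>F. (\<Sum>m<n. c m * a m h) * h z)"
      by (subst sum.swap) (simp add: sum_distrib_right)
    finally show ?thesis by (simp add: c(2))
  qed
  then show ?thesis using c(1) by blast
qed

text \<open>
  The base \<open>n\<close> digits of \<open>m < n ^ q\<close> encode the exponents, all below \<open>n\<close>, of a monomial in \<open>q\<close>
  variables. With this numbering the substitution of \<open>t ^ (n ^ j)\<close> for the variable \<open>j\<close> sends the monomial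
  number \<open>m\<close> to \<open>t ^ m\<close>.
\<close>

definition digit :: "nat \<Rightarrow> nat \<Rightarrow> nat \<Rightarrow> nat" where
  "digit n m j = (m div n ^ j) mod n"

lemma digit_sum: "(\<Sum>j<q. digit n m j * n ^ j) = m mod n ^ q"
proof (induction q)
  case (Suc q)
  have "m mod n ^ Suc q = n ^ q * (m div n ^ q mod n) + m mod n ^ q"
    using mod_mult2_eq[of m "n ^ q" n] by (simp add: mult.commute)
  then show ?case using Suc by (simp add: digit_def ac_simps)
qed simp

text \<open>
  After multiplication by a power of \<open>b\<close>, the \<open>n ^ q\<close> monomials in the \<open>\<phi> j\<close> with exponents below \<open>n\<close> all
  lie in the span of products of elements of \<open>E\<close> with monomials in \<open>U\<close> whose exponents are linear in
  \<open>n\<close>. The number of these products grows only like \<open>n ^ card U\<close>, so for large \<open>n\<close> there is a linear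
  relation.
\<close>

theorem algebraic_dependence:
  assumes fin: "finite_over Z U D \<Phi>" and D: "\<And>b z. b \<in> D \<Longrightarrow> z \<in> Z \<Longrightarrow> b z \<noteq> 0"
    and U: "finite U" "card U < q" and \<phi>: "\<And>j. j < q \<Longrightarrow> \<phi> j \<in> \<Phi>"
  shows "\<exists>n c. (\<exists>m<n ^ q. c m \<noteq> 0) \<and>
    (\<forall>z\<in>Z. (\<Sum>m<n ^ q. c m * (\<Prod>j<q. \<phi> j z ^ digit n m j)) = 0)"
proof -
  obtain b E where b: "b \<in> D" "b \<in> multipliers Z U E" and E: "finite E" "(\<lambda>_. 1) \<in> E"
    and b\<phi>: "\<And>\<phi>. \<phi> \<in> \<Phi> \<Longrightarrow> (\<lambda>z. b z * \<phi> z) \<in> multipliers Z U E"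
    using fin unfolding finite_over_def by blast
  let ?H = "\<lambda>N. ftimes (monomials U N) E"
  have H_mono: "fspan Z (?H K) \<subseteq> fspan Z (?H L)" if "K \<le> L" for K L
    by (intro fspan_mono ftimes_mono monomials_mono that order_refl)
  define X where "X = insert (\<lambda>z. b z) ((\<lambda>j z. b z * \<phi> j z) ` {..<q})"
  have X: "finite X" "X \<subseteq> multipliers Z U E" unfolding X_def using b(2) b\<phi> \<phi> by auto
  have "\<exists>N. \<forall>\<xi>\<in>X. \<forall>e\<in>E. (\<lambda>z. \<xi> z * e z) \<in> fspan Z (?H N)"
  proof -
    have "\<exists>N. (\<lambda>z. \<xi> z * e z) \<in> fspan Z (?H N)" if "\<xi> \<in> X" "e \<in> E" for \<xi> e
      using that X(2) by (intro fmod_bounded_degree[OF U(1)]) (auto simp: multipliers_def)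
    then obtain N where N: "\<And>\<xi> e. \<xi> \<in> X \<Longrightarrow> e \<in> E \<Longrightarrow> (\<lambda>z. \<xi> z * e z) \<in> fspan Z (?H (N \<xi> e))"
      by metis
    let ?N = "\<Sum>\<xi>\<in>X. \<Sum>e\<in>E. N \<xi> e"
    have "N \<xi> e \<le> ?N" if "\<xi> \<in> X" "e \<in> E" for \<xi> e
    proof -
      have "N \<xi> e \<le> (\<Sum>e\<in>E. N \<xi> e)" using that E by (intro member_le_sum) auto
      also have "\<dots> \<le> ?N" using that X by (intro member_le_sum[where f = "\<lambda>\<xi>. \<Sum>e\<in>E. N \<xi> e"]) auto
      finally show ?thesis .
    qed
    then have "(\<lambda>z. \<xi> z * e z) \<in> fspan Z (?H ?N)" if "\<xi> \<in> X" "e \<in> E" for \<xi> e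
      using subsetD[OF H_mono N[OF that], of ?N] that by blast
    then show ?thesis by blast
  qed
  then obtain N where N: "\<And>\<xi> e. \<xi> \<in> X \<Longrightarrow> e \<in> E \<Longrightarrow> (\<lambda>z. \<xi> z * e z) \<in> fspan Z (?H N)" by blast
  \<comment> \<open>Multiplication by \<open>b\<close> or \<open>b * \<phi> j\<close> raises the exponents by at most \<open>N\<close>.\<close>
  have act: "(\<lambda>z. \<xi> z * f z) \<in> fspan Z (?H (K + N))" if \<xi>: "\<xi> \<in> X" and f: "f \<in> fspan Z (?H K)" for \<xi> f K
  proof -
    have "(\<lambda>z. f z * \<xi> z) \<in> fspan Z (?H (K + N))"
    proof (rule fspan_mult_left[OF f])
      fix h assume "h \<in> ?H K"
      then obtain u e where h: "u \<in> monomials U K" "e \<in> E" "h = (\<lambda>z. u z * e z)" by (rule ftimesE)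
      have "(\<lambda>z. \<xi> z * e z * u z) \<in> fspan Z (?H (K + N))"
      proof (rule fspan_mult_left[OF N[OF \<xi> h(2)]])
        fix k assume "k \<in> ?H N"
        then obtain v e' where k: "v \<in> monomials U N" "e' \<in> E" "k = (\<lambda>z. v z * e' z)" by (rule ftimesE)
        from ftimesI[OF monomials_mult[OF h(1) k(1)] k(2)]
        show "(\<lambda>z. k z * u z) \<in> fspan Z (?H (K + N))" unfolding k(3) by (intro fspan_base) (simp add: ac_simps)
      qed
      then show "(\<lambda>z. h z * \<xi> z) \<in> fspan Z (?H (K + N))" unfolding h(3) by (simp add: ac_simps)
    qed
    then show ?thesis by (simp add: mult.commute)
  qed
  have power: "(\<lambda>z. \<xi> z ^ t * f z) \<in> fspan Z (?H (t * N + K))" if "\<xi> \<in> X" "f \<in> fspan Z (?H K)" for \<xi> t f K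
  proof (induction t)
    case (Suc t)
    from act[OF that(1) Suc] show ?case by (simp add: ac_simps)
  qed (use that in simp)
  have prod: "(\<lambda>z. (\<Prod>j<i. (b z * \<phi> j z) ^ \<alpha> j) * f z) \<in> fspan Z (?H ((\<Sum>j<i. \<alpha> j) * N + K))"
    if "i \<le> q" "f \<in> fspan Z (?H K)" for i \<alpha> f K
    using that(1)
  proof (induction i)
    case (Suc i)
    have "(\<lambda>z. b z * \<phi> i z) \<in> X" unfolding X_def using Suc.prems by auto
    from power[OF this Suc.IH, of "\<alpha> i"] Suc.prems show ?case by (simp add: algebra_simps)
  qed (use that in simp)
  have one: "(\<lambda>_. 1) \<in> fspan Z (?H 0)"
    using ftimesI[OF monomialsI[of U "\<lambda>_. 0" 0] E(2)] by (intro fspan_base) simp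
  have key: "(\<lambda>z. b z ^ t * (\<Prod>j<q. \<phi> j z ^ \<alpha> j)) \<in> fspan Z (?H (t * N))"
    if t: "(\<Sum>j<q. \<alpha> j) \<le> t" for \<alpha> t
  proof -
    let ?s = "\<Sum>j<q. \<alpha> j"
    have bX: "b \<in> X" unfolding X_def by simp
    have "(\<lambda>z. b z ^ (t - ?s) * ((\<Prod>j<q. (b z * \<phi> j z) ^ \<alpha> j) * 1)) \<in> fspan Z (?H ((t - ?s) * N + (?s * N + 0)))"
      by (rule power[OF bX prod[OF order_refl one]])
    also have "(t - ?s) * N + (?s * N + 0) = t * N"
      using t by (metis add.right_neutral add_mult_distrib le_add_diff_inverse2)
    finally have "(\<lambda>z. b z ^ (t - ?s) * (\<Prod>j<q. (b z * \<phi> j z) ^ \<alpha> j)) \<in> fspan Z (?H (t * N))" by simp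
    moreover have "b z ^ t * (\<Prod>j<q. \<phi> j z ^ \<alpha> j) = b z ^ (t - ?s) * (\<Prod>j<q. (b z * \<phi> j z) ^ \<alpha> j)" for z
    proof -
      have "(\<Prod>j<q. (b z * \<phi> j z) ^ \<alpha> j) = b z ^ ?s * (\<Prod>j<q. \<phi> j z ^ \<alpha> j)"
        by (simp add: power_mult_distrib prod.distrib power_sum)
      then show ?thesis using t by (simp add: mult.assoc[symmetric] power_add[symmetric])
    qed
    ultimately show ?thesis by simp
  qed
  \<comment> \<open>Compare the growth of order \<open>q\<close> of the number of monomials with the one of order \<open>card U\<close> of the span.\<close>
  define r where "r = card U"
  define C where "C = (q * N + 1) ^ r * card E"
  define n where "n = C + 1"
  define t where "t = q * n"
  have "card (?H (t * N)) < n ^ q"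
  proof -
    have "card (?H (t * N)) \<le> card (monomials U (t * N)) * card E"
      using U E by (intro card_ftimes_le finite_monomials)
    also have "\<dots> \<le> Suc (t * N) ^ r * card E"
      unfolding r_def using U by (intro mult_right_mono card_monomials_le) auto
    also have "Suc (t * N) \<le> (q * N + 1) * n" by (simp add: t_def n_def algebra_simps)
    then have "Suc (t * N) ^ r * card E \<le> ((q * N + 1) * n) ^ r * card E"
      by (intro mult_right_mono power_mono) auto
    also have "\<dots> = C * n ^ r" unfolding C_def power_mult_distrib by (simp only: ac_simps)
    also have "\<dots> < n * n ^ r" by (simp add: n_def)
    also have "\<dots> \<le> n ^ q" using U(2) power_increasing[of "Suc r" q n] by (simp add: r_def n_def)
    finally show ?thesis .
  qed
  moreover have "finite (?H (t * N))" using U E by (intro finite_ftimes finite_monomials)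
  moreover have "(\<lambda>z. b z ^ t * (\<Prod>j<q. \<phi> j z ^ digit n m j)) \<in> fspan Z (?H (t * N))" for m
  proof (rule key)
    have "(\<Sum>j<q. digit n m j) \<le> (\<Sum>j<q. n)" by (intro sum_mono) (simp add: digit_def n_def less_imp_le)
    then show "(\<Sum>j<q. digit n m j) \<le> t" by (simp add: t_def)
  qed
  ultimately obtain c where c: "\<exists>m<n ^ q. c m \<noteq> 0"
    "\<And>z. z \<in> Z \<Longrightarrow> (\<Sum>m<n ^ q. c m * (b z ^ t * (\<Prod>j<q. \<phi> j z ^ digit n m j))) = 0"
    using fspan_dependent[of "?H (t * N)" "n ^ q" "\<lambda>m z. b z ^ t * (\<Prod>j<q. \<phi> j z ^ digit n m j)" Z] by blast
  have "(\<Sum>m<n ^ q. c m * (\<Prod>j<q. \<phi> j z ^ digit n m j)) = 0" if "z \<in> Z" for z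
  proof -
    have "b z ^ t * (\<Sum>m<n ^ q. c m * (\<Prod>j<q. \<phi> j z ^ digit n m j)) = 0"
      using c(2)[OF that] by (simp add: sum_distrib_left ac_simps)
    then show ?thesis using D[OF b(1) that] by simp
  qed
  then show ?thesis using c(1) by blast
qed

text \<open>
  Kronecker's substitution turns the polynomial into one in a single variable with the same
  coefficients, so a nonzero coefficient vector gives a nonzero polynomial function.
\<close>

lemma kronecker_substitution:
  fixes c :: "nat \<Rightarrow> real"
  assumes "\<exists>m<n ^ q. c m \<noteq> 0"
  shows "\<exists>t::real. (\<Sum>m<n ^ q. c m * (\<Prod>j<q. (t ^ (n ^ j)) ^ digit n m j)) \<noteq> 0"
proof -
  have eq: "(\<Prod>j<q. (t ^ (n ^ j)) ^ digit n m j) = t ^ m" if "m < n ^ q" for t :: real and m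
  proof -
    have "(\<Prod>j<q. (t ^ (n ^ j)) ^ digit n m j) = t ^ (\<Sum>j<q. digit n m j * n ^ j)"
      by (simp add: power_sum power_mult[symmetric] mult.commute)
    also have "(\<Sum>j<q. digit n m j * n ^ j) = m" using that by (simp add: digit_sum)
    finally show ?thesis .
  qed
  obtain m0 where m0: "m0 < n ^ q" "c m0 \<noteq> 0" using assms by blast
  then obtain k where k: "n ^ q = Suc k" by (cases "n ^ q") auto
  have "\<not> (\<forall>t. (\<Sum>m\<le>k. c m * t ^ m) = 0)"
    using m0 k polyfun_eq_0[of c k] by auto
  then show ?thesis using eq by (simp add: k lessThan_Suc_atMost)
qed

section \<open>Algebraically independent coordinates\<close>

definition coords :: "'a::euclidean_space set \<Rightarrow> ('a \<Rightarrow> real) set" where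
  "coords T = (\<lambda>c x. x \<bullet> c) ` T"

lemma real_polynomial_function_falg_coords:
  "f \<in> falg (coords T) \<Longrightarrow> real_polynomial_function f"
  by (induction rule: falg.induct) (auto simp: coords_def intro: bounded_linear_inner_left)

lemma falg_coords_real_polynomial_function:
  assumes "real_polynomial_function (f :: 'a::euclidean_space \<Rightarrow> real)"
  shows "f \<in> falg (coords Basis)"
  using assms
proof induction
  case (linear f)
  interpret bounded_linear f by (rule linear)
  have "f x = (\<Sum>c\<in>Basis. f c * (x \<bullet> c))" for x
  proof -
    have "f x = f (\<Sum>c\<in>Basis. (x \<bullet> c) *\<^sub>R c)" by (simp add: euclidean_representation)
    also have "\<dots> = (\<Sum>c\<in>Basis. f c * (x \<bullet> c))" by (simp add: sum scaleR mult.commute)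
    finally show ?thesis .
  qed
  then have f: "f = (\<lambda>x. \<Sum>c\<in>Basis. f c * (x \<bullet> c))" by (rule ext)
  show ?case
    by (subst f, intro falg_sum falg_scale falg.gen) (auto simp: coords_def)
qed (auto intro: falg.intros)

text \<open>
  On the line through \<open>x\<close> and \<open>y\<close> both functions are nonzero polynomials in one variable, which have
  finitely many zeros.
\<close>

lemma real_polynomial_function_nonzero_mult:
  fixes f g :: "'a::euclidean_space \<Rightarrow> real"
  assumes f: "real_polynomial_function f" "f x \<noteq> 0" and g: "real_polynomial_function g" "g y \<noteq> 0"
  shows "\<exists>z. f z * g z \<noteq> 0"
proof -
  define p where "p t = x + t *\<^sub>R (y - x)" for t :: real
  have p: "polynomial_function p"
    unfolding p_def by (intro polynomial_function_add polynomial_function_const polynomial_function_mult polynomial_function_id)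
  have fin: "finite {t. h (p t) = 0}" if h: "real_polynomial_function h" "h (p s) \<noteq> 0" for h s
  proof -
    have "real_polynomial_function (h \<circ> p)" by (rule real_polynomial_function_compose[OF p h(1)])
    then obtain a n where a: "h \<circ> p = (\<lambda>t. \<Sum>i\<le>n. a i * t ^ i)"
      using real_polynomial_function_iff_sum by blast
    then have eq: "h (p t) = (\<Sum>i\<le>n. a i * t ^ i)" for t by (metis comp_apply)
    have "\<exists>i\<le>n. a i \<noteq> 0"
    proof (rule ccontr)
      assume "\<not> ?thesis"
      then have "h (p s) = 0" unfolding eq by (intro sum.neutral) auto
      then show False using h(2) by simp
    qed
    then show ?thesis unfolding eq using polyfun_finite_roots[of a n] by blast
  qed
  have "finite ({t. f (p t) = 0} \<union> {t. g (p t) = 0})"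
    using fin[OF f(1), of 0] fin[OF g(1), of 1] f(2) g(2) by (simp add: p_def)
  then obtain t where "t \<notin> {t. f (p t) = 0} \<union> {t. g (p t) = 0}"
    using ex_new_if_finite[OF infinite_UNIV_char_0] by blast
  then show ?thesis by (intro exI[of _ "p t"]) auto
qed

lemma real_polynomial_function_nonzero_prod:
  fixes f :: "'i \<Rightarrow> 'a::euclidean_space \<Rightarrow> real"
  assumes "finite I" and "\<And>i. i \<in> I \<Longrightarrow> real_polynomial_function (f i)" and "\<And>i. i \<in> I \<Longrightarrow> \<exists>x. f i x \<noteq> 0"
  shows "\<exists>x. (\<Prod>i\<in>I. f i x) \<noteq> 0"
  using assms
proof (induction I)
  case (insert i I)
  obtain x where x: "f i x \<noteq> 0" using insert.prems by blast
  obtain y where y: "(\<Prod>i\<in>I. f i y) \<noteq> 0" using insert by auto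
  have "\<exists>z. f i z * (\<Prod>i\<in>I. f i z) \<noteq> 0"
    by (rule real_polynomial_function_nonzero_mult[where f = "f i" and g = "\<lambda>z. \<Prod>i\<in>I. f i z", OF _ x _ y])
      (use insert in auto)
  then show ?case using insert.hyps by simp
qed simp

lemma falg_insert_expansion:
  assumes "f \<in> falg (insert v U)"
  shows "\<exists>n a. (\<forall>i. a i \<in> falg U) \<and> (\<forall>i>n. a i = (\<lambda>_. 0)) \<and> (\<forall>z. f z = (\<Sum>i\<le>n. a i z * v z ^ i))"
  using assms
proof induction
  case (const c)
  show ?case
    by (rule exI[of _ 0], rule exI[of _ "\<lambda>i. if i = 0 then (\<lambda>_. c) else (\<lambda>_. 0)"])
      (auto intro: falg.const)
next
  case (gen u)
  show ?case
  proof (cases "u = v")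
    case True
    show ?thesis
      by (rule exI[of _ 1], rule exI[of _ "\<lambda>i. if i = 1 then (\<lambda>_. 1) else (\<lambda>_. 0)"])
        (auto simp: True intro: falg.const)
  next
    case False
    then have "u \<in> U" using gen by simp
    then show ?thesis
      by (intro exI[of _ 0] exI[of _ "\<lambda>i. if i = 0 then u else (\<lambda>_. 0)"])
        (auto intro: falg.const falg.gen)
  qed
next
  case (add f g)
  then obtain m a n b where a: "\<And>i. a i \<in> falg U" "\<And>i. i > m \<Longrightarrow> a i = (\<lambda>_. 0)" "\<And>z. f z = (\<Sum>i\<le>m. a i z * v z ^ i)"
    and b: "\<And>i. b i \<in> falg U" "\<And>i. i > n \<Longrightarrow> b i = (\<lambda>_. 0)" "\<And>z. g z = (\<Sum>i\<le>n. b i z * v z ^ i)"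
    by blast
  have "f z + g z = (\<Sum>i\<le>max m n. (a i z + b i z) * v z ^ i)" for z
  proof -
    have "f z = (\<Sum>i\<le>max m n. a i z * v z ^ i)"
      unfolding a(3) by (rule sum.mono_neutral_left) (auto simp: a(2))
    moreover have "g z = (\<Sum>i\<le>max m n. b i z * v z ^ i)"
      unfolding b(3) by (rule sum.mono_neutral_left) (auto simp: b(2))
    ultimately show ?thesis by (simp add: distrib_right sum.distrib)
  qed
  then show ?case
    by (intro exI[of _ "max m n"] exI[of _ "\<lambda>i z. a i z + b i z"]) (auto simp: a b intro: falg.add)
next
  case (mult f g)
  then obtain m a n b where a: "\<And>i. a i \<in> falg U" "\<And>i. i > m \<Longrightarrow> a i = (\<lambda>_. 0)" "\<And>z. f z = (\<Sum>i\<le>m. a i z * v z ^ i)"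
    and b: "\<And>i. b i \<in> falg U" "\<And>i. i > n \<Longrightarrow> b i = (\<lambda>_. 0)" "\<And>z. g z = (\<Sum>i\<le>n. b i z * v z ^ i)"
    by blast
  let ?c = "\<lambda>k z. \<Sum>i\<le>k. a i z * b (k - i) z"
  have "f z * g z = (\<Sum>k\<le>m + n. ?c k z * v z ^ k)" for z
    unfolding a(3) b(3) by (rule polynomial_product) (simp_all add: a(2) b(2))
  moreover have "?c k \<in> falg U" for k by (intro falg_sum falg.mult a b)
  moreover have "?c k = (\<lambda>_. 0)" if "k > m + n" for k
  proof
    fix z
    show "?c k z = 0"
    proof (rule sum.neutral, intro ballI)
      fix i assume "i \<in> {..k}"
      then have "i > m \<or> k - i > n" using that by auto
      then show "a i z * b (k - i) z = 0" by (auto simp: a(2) b(2))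
    qed
  qed
  ultimately show ?case by (intro exI[of _ "m + n"] exI[of _ ?c]) blast
qed

definition alg_indep :: "'a::euclidean_space set \<Rightarrow> 'a set \<Rightarrow> bool" where
  "alg_indep T M \<longleftrightarrow> (\<forall>f\<in>falg (coords T). (\<forall>x\<in>M. f x = 0) \<longrightarrow> (\<forall>x. f x = 0))"

lemma alg_indep_subset: "alg_indep T M' \<Longrightarrow> M' \<subseteq> M \<Longrightarrow> alg_indep T M"
  unfolding alg_indep_def by blast

lemma alg_indep_empty:
  assumes "M \<noteq> {}" shows "alg_indep {} M"
proof -
  have "\<exists>c. f = (\<lambda>_. c)" if "f \<in> falg {}" for f :: "'a \<Rightarrow> real"
    using that by induction auto
  then show ?thesis using assms unfolding alg_indep_def coords_def image_empty by (metis ex_in_conv)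
qed

text \<open>
  A polynomial relation that involves \<open>c\<close> is sorted by powers of \<open>x \<bullet> c\<close> and cut off at the last
  coefficient that is not identically zero. This power is not the zeroth one, since otherwise the
  coefficient itself would be a relation between the coordinates in \<open>T\<close>.
\<close>

lemma algebraic_equation_of_dependent:
  assumes indep: "alg_indep T M" and dep: "\<not> alg_indep (insert c T) M"
  shows "\<exists>n>0. \<exists>a. (\<forall>i\<le>n. a i \<in> falg (coords T)) \<and> (\<exists>x. a n x \<noteq> 0) \<and>
    (\<forall>x\<in>M. (\<Sum>i\<le>n. a i x * (x \<bullet> c) ^ i) = 0)"
proof -
  obtain f y where f: "f \<in> falg (coords (insert c T))" "\<And>x. x \<in> M \<Longrightarrow> f x = 0" "f y \<noteq> 0"
    using dep unfolding alg_indep_def by blast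
  have "f \<in> falg (insert (\<lambda>x. x \<bullet> c) (coords T))" using f(1) by (simp add: coords_def)
  then obtain n a where a: "\<And>i. a i \<in> falg (coords T)" "\<And>x. f x = (\<Sum>i\<le>n. a i x * (x \<bullet> c) ^ i)"
    using falg_insert_expansion[of f "\<lambda>x. x \<bullet> c" "coords T"] by blast
  define J where "J = {i. i \<le> n \<and> a i \<noteq> (\<lambda>_. 0)}"
  have "J \<noteq> {}"
  proof
    assume "J = {}"
    then have "f y = 0" unfolding a(2) J_def by (intro sum.neutral) auto
    then show False using f(3) by simp
  qed
  have J: "finite J" unfolding J_def by simp
  define d where "d = Max J"
  have "d \<in> J" unfolding d_def using J \<open>J \<noteq> {}\<close> by simp
  then have d: "d \<le> n" "a d \<noteq> (\<lambda>_. 0)" unfolding J_def by auto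
  have top: "a i x = 0" if "i \<le> n" "i > d" for i x
  proof (rule ccontr)
    assume "a i x \<noteq> 0"
    then have "i \<in> J" using that unfolding J_def by auto
    then show False using that Max_ge[OF J, of i] unfolding d_def by simp
  qed
  have eq: "f x = (\<Sum>i\<le>d. a i x * (x \<bullet> c) ^ i)" for x
    unfolding a(2) by (rule sum.mono_neutral_right) (use d top in auto)
  have "d > 0"
  proof (rule ccontr)
    assume "\<not> 0 < d"
    then have d0: "d = 0" by simp
    then have "f x = a 0 x" for x by (simp add: eq)
    then have "\<forall>x. a 0 x = 0" using indep a(1)[of 0] f(2) unfolding alg_indep_def by auto
    then show False using d(2) unfolding d0 by auto
  qed
  moreover have "\<exists>x. a d x \<noteq> 0" using d(2) by auto
  moreover have "(\<Sum>i\<le>d. a i x * (x \<bullet> c) ^ i) = 0" if "x \<in> M" for x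
    using f(2)[OF that] by (simp add: eq)
  ultimately show ?thesis using a(1) by blast
qed

text \<open>
  Maximality makes every remaining coordinate algebraic over those in \<open>T\<close>; the denominator \<open>b\<close> is the
  product of the leading coefficients of the equations.
\<close>

lemma generic_finiteness:
  fixes T M :: "'a::euclidean_space set"
  assumes indep: "alg_indep T M" and max: "\<And>c. c \<in> Basis - T \<Longrightarrow> \<not> alg_indep (insert c T) M"
    and T: "T \<subseteq> Basis"
  obtains b where "b \<in> falg (coords T)" "\<exists>x. b x \<noteq> 0"
    "finite_over {x \<in> M. b x \<noteq> 0} (coords T)
       {f \<in> falg (coords T). \<forall>x\<in>{x \<in> M. b x \<noteq> 0}. f x \<noteq> 0} (coords Basis)"
proof -
  let ?Q = "\<lambda>c n a. n > 0 \<and> (\<forall>i\<le>n. a i \<in> falg (coords T)) \<and> (\<exists>x. a n x \<noteq> 0) \<and>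
    (\<forall>x\<in>M. (\<Sum>i\<le>n. a i x * (x \<bullet> c) ^ i) = 0)"
  have "\<forall>c\<in>Basis - T. \<exists>p. ?Q c (fst p) (snd p)"
  proof
    fix c assume c: "c \<in> Basis - T"
    obtain n a where "?Q c n a" using algebraic_equation_of_dependent[OF indep max[OF c]] by blast
    then show "\<exists>p. ?Q c (fst p) (snd p)" by (intro exI[of _ "(n, a)"]) simp
  qed
  from bchoice[OF this] obtain p where p: "\<forall>c\<in>Basis - T. ?Q c (fst (p c)) (snd (p c))" ..
  define n a where "n c = fst (p c)" and "a c = snd (p c)" for c
  have na: "n c > 0" "\<And>i. i \<le> n c \<Longrightarrow> a c i \<in> falg (coords T)" "\<exists>x. a c (n c) x \<noteq> 0"
    "\<And>x. x \<in> M \<Longrightarrow> (\<Sum>i\<le>n c. a c i x * (x \<bullet> c) ^ i) = 0" if "c \<in> Basis - T" for c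
    using bspec[OF p that] unfolding n_def a_def by blast+
  define b where "b x = (\<Prod>c\<in>Basis - T. a c (n c) x)" for x
  have b: "b \<in> falg (coords T)" unfolding b_def by (intro falg_prod na order_refl)
  have nz: "\<exists>x. b x \<noteq> 0" unfolding b_def
    by (rule real_polynomial_function_nonzero_prod)
      (auto intro!: real_polynomial_function_falg_coords[of _ T] na)
  let ?Z = "{x \<in> M. b x \<noteq> 0}" and ?D = "{f \<in> falg (coords T). \<forall>x\<in>{x \<in> M. b x \<noteq> 0}. f x \<noteq> 0}"
  have D: "denominators ?D" unfolding denominators_def by (auto intro: falg.intros)
  have "finite_over ?Z (coords T) ?D (coords (Basis - T) \<union> falg (coords T))"
  proof (rule finite_over_adjoin_algebraic[OF D finite_over_falg[OF D]])
    show "finite (coords (Basis - T))" unfolding coords_def by simp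
    fix f :: "'a \<Rightarrow> real" assume "f \<in> coords (Basis - T)"
    then obtain c where c: "c \<in> Basis - T" "f = (\<lambda>x. x \<bullet> c)" unfolding coords_def by blast
    have "a c (n c) x \<noteq> 0" if "x \<in> ?Z" for x
      using that c(1) unfolding b_def by (auto simp: prod_zero_iff)
    then have "a c (n c) \<in> ?D" using na(2)[OF c(1)] by blast
    then show "algebraic_over ?Z ?D (falg (coords T)) f"
      unfolding algebraic_over_def c(2) using na[OF c(1)]
      by (intro exI[of _ "n c"] conjI exI[of _ "a c"]) (auto intro: falg.gen)
  qed
  then have "finite_over ?Z (coords T) ?D (coords Basis)"
    by (rule finite_over_subset) (auto simp: coords_def intro!: falg.gen)
  with b nz show thesis by (rule that)
qed

lemma finite_over_mono_denominators: "finite_over Z U D \<Phi> \<Longrightarrow> D \<subseteq> D' \<Longrightarrow> finite_over Z U D' \<Phi>"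
  unfolding finite_over_def by blast

text \<open>
  For a maximal independent \<open>T\<close> with denominator \<open>b\<close>, the part of \<open>M\<close> where \<open>b\<close> does not vanish is one
  piece. On the rest \<open>b\<close> is a nonzero polynomial in the coordinates of \<open>T\<close> that vanishes, so \<open>T\<close> is
  no longer independent there, and no new independent sets appear. The induction is on the number of
  independent sets; it replaces the decomposition into irreducible components.
\<close>

lemma stratification:
  fixes M :: "'a::euclidean_space set"
  shows "\<exists>\<Z>. finite \<Z> \<and> M = \<Union>\<Z> \<and> (\<forall>Z\<in>\<Z>. \<exists>T\<subseteq>Basis. alg_indep T M \<and>
    finite_over Z (coords T) {f. \<forall>x\<in>Z. f x \<noteq> 0} (coords Basis))"
proof (induction "card {T. T \<subseteq> Basis \<and> alg_indep T M}" arbitrary: M rule: less_induct)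
  case less
  let ?I = "\<lambda>M :: 'a set. {T. T \<subseteq> Basis \<and> alg_indep T M}"
  have fin: "finite (?I M)" for M :: "'a set" by (rule finite_subset[of _ "Pow Basis"]) auto
  show ?case
  proof (cases "M = {}")
    case True
    then show ?thesis by (intro exI[of _ "{}"]) simp
  next
    case False
    have "{} \<in> ?I M" using alg_indep_empty[OF False] by simp
    then have "?I M \<noteq> {}" by blast
    from finite_has_maximal[OF fin this]
    obtain T where T: "T \<in> ?I M" and max: "\<forall>T'\<in>?I M. T \<subseteq> T' \<longrightarrow> T = T'" by (rule bexE)
    have max': "\<not> alg_indep (insert c T) M" if "c \<in> Basis - T" for c
      using bspec[OF max, of "insert c T"] that T by auto
    obtain b where b: "b \<in> falg (coords T)" "\<exists>x. b x \<noteq> 0"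
      "finite_over {x \<in> M. b x \<noteq> 0} (coords T)
         {f \<in> falg (coords T). \<forall>x\<in>{x \<in> M. b x \<noteq> 0}. f x \<noteq> 0} (coords Basis)"
      using generic_finiteness[of T M] T max' by blast
    let ?M1 = "{x \<in> M. b x \<noteq> 0}" and ?M2 = "{x \<in> M. b x = 0}"
    have "T \<notin> ?I ?M2" using b(1,2) unfolding alg_indep_def by blast
    moreover have "?I ?M2 \<subseteq> ?I M" using alg_indep_subset[of _ ?M2 M] by blast
    ultimately have "?I ?M2 \<subset> ?I M" using T by blast
    then have "card (?I ?M2) < card (?I M)" by (rule psubset_card_mono[OF fin])
    from less[OF this] obtain \<Z> where \<Z>: "finite \<Z>" "?M2 = \<Union>\<Z>"
      "\<And>Z. Z \<in> \<Z> \<Longrightarrow> \<exists>T\<subseteq>Basis. alg_indep T ?M2 \<and>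
        finite_over Z (coords T) {f. \<forall>x\<in>Z. f x \<noteq> 0} (coords Basis)" by blast
    have "M = \<Union>(insert ?M1 \<Z>)" using \<Z>(2) by auto
    moreover have "\<exists>T\<subseteq>Basis. alg_indep T M \<and>
        finite_over Z (coords T) {f. \<forall>x\<in>Z. f x \<noteq> 0} (coords Basis)" if "Z \<in> insert ?M1 \<Z>" for Z
    proof (cases "Z \<in> \<Z>")
      case True
      then show ?thesis using \<Z>(3) alg_indep_subset[of _ ?M2 M] by blast
    next
      case False
      then have Z: "Z = ?M1" using that by blast
      have "finite_over ?M1 (coords T) {f. \<forall>x\<in>?M1. f x \<noteq> 0} (coords Basis)"
        by (rule finite_over_mono_denominators[OF b(3)]) auto
      then show ?thesis using T unfolding Z by blast
    qed
    ultimately show ?thesis using \<Z>(1) by (intro exI[of _ "insert ?M1 \<Z>"]) simp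
  qed
qed

section \<open>Independent coordinates and Krull dimension\<close>

lemma polynomial_ring_nat_pow:
  fixes f :: "'a::euclidean_space \<Rightarrow> real"
  shows "f [^]\<^bsub>polynomial_ring\<^esub> (m::nat) = (\<lambda>x. f x ^ m)"
  by (induction m) (simp_all add: polynomial_ring_def nat_pow_def mult.commute)

text \<open>
  Expanding the nested expression shows the leading monomial explicitly. If the entries are regarded as
  independent variables, the monomials in the sum are larger than it in the lexicographic order.
\<close>

lemma iterated_boundary_polynomial_ring:
  fixes r :: "'a::euclidean_space \<Rightarrow> real"
  assumes "r \<in> iterated_boundary polynomial_ring ys"
  shows "\<exists>m a. (\<forall>i<length ys. real_polynomial_function (a i)) \<and>
    (\<forall>x. r x = (\<Prod>i<length ys. (ys ! i) x ^ m i) +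
       (\<Sum>i<length ys. a i x * ((ys ! i) x * (\<Prod>j\<le>i. (ys ! j) x ^ m j))))"
  using assms
proof (induction ys arbitrary: r)
  case Nil
  then show ?case by (simp add: polynomial_ring_def)
next
  case (Cons y ys)
  obtain k s b where r: "r = y [^]\<^bsub>polynomial_ring\<^esub> (k::nat) \<otimes>\<^bsub>polynomial_ring\<^esub>
      (s \<oplus>\<^bsub>polynomial_ring\<^esub> b \<otimes>\<^bsub>polynomial_ring\<^esub> y)"
    and s: "s \<in> iterated_boundary polynomial_ring ys" and b: "b \<in> carrier polynomial_ring"
    using Cons.prems by auto
  have r': "r x = y x ^ k * (s x + b x * y x)" for x
    unfolding r polynomial_ring_nat_pow by (simp add: polynomial_ring_def)
  obtain m a where a: "\<And>i. i < length ys \<Longrightarrow> real_polynomial_function (a i)"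
    and s': "\<And>x. s x = (\<Prod>i<length ys. (ys ! i) x ^ m i) +
       (\<Sum>i<length ys. a i x * ((ys ! i) x * (\<Prod>j\<le>i. (ys ! j) x ^ m j)))"
    using Cons.IH[OF s] by blast
  let ?m = "case_nat k m" and ?a = "case_nat b a"
  have "real_polynomial_function (?a i)" if "i < length (y # ys)" for i
    using that a b by (cases i) (auto simp: polynomial_ring_def)
  moreover have "r x = (\<Prod>i<length (y # ys). ((y # ys) ! i) x ^ ?m i) +
       (\<Sum>i<length (y # ys). ?a i x * (((y # ys) ! i) x * (\<Prod>j\<le>i. ((y # ys) ! j) x ^ ?m j)))" for x
  proof -
    have "(\<Prod>i<length (y # ys). ((y # ys) ! i) x ^ ?m i) = y x ^ k * (\<Prod>i<length ys. (ys ! i) x ^ m i)"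
      by (simp only: length_Cons prod.lessThan_Suc_shift) simp
    moreover have "(\<Sum>i<length (y # ys). ?a i x * (((y # ys) ! i) x * (\<Prod>j\<le>i. ((y # ys) ! j) x ^ ?m j)))
      = b x * (y x * y x ^ k) +
        (\<Sum>i<length ys. a i x * ((ys ! i) x * (y x ^ k * (\<Prod>j\<le>i. (ys ! j) x ^ m j))))"
      by (simp only: length_Cons sum.lessThan_Suc_shift prod.atMost_Suc_shift) simp
    ultimately show ?thesis unfolding r' s' by (simp add: algebra_simps sum_distrib_left)
  qed
  ultimately show ?case by blast
qed

lemma fmod_explicit:
  assumes "f \<in> fmod Z U E" "finite E"
  shows "\<exists>c. (\<forall>e. c e \<in> falg U) \<and> (\<forall>z\<in>Z. f z = (\<Sum>e\<in>E. c e z * e z))"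
  using assms(1)[unfolded fmod_def]
proof induction
  case (zero f)
  then show ?case by (intro exI[of _ "\<lambda>_ _. 0"]) (auto intro: falg.const)
next
  case (step g h f r)
  obtain c where c: "\<And>e. c e \<in> falg U" "\<And>z. z \<in> Z \<Longrightarrow> g z = (\<Sum>e\<in>E. c e z * e z)"
    using step by blast
  obtain d k where h: "d \<in> falg U" "k \<in> E" "h = (\<lambda>z. d z * k z)" using step(2) by (rule ftimesE)
  let ?c = "\<lambda>e z. c e z + (if e = k then r else 0) * d z"
  have "?c e \<in> falg U" for e by (intro falg.add falg.mult falg.const c h)
  moreover have "f z = (\<Sum>e\<in>E. ?c e z * e z)" if "z \<in> Z" for z
  proof -
    have "(\<Sum>e\<in>E. (if e = k then r else 0) * d z * e z) = (\<Sum>e\<in>E. if e = k then r * d z * k z else 0)"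
      by (rule sum.cong) auto
    also have "\<dots> = r * h z" using assms(2) h by simp
    finally show ?thesis using step(3)[OF that] c(2)[OF that]
      by (simp add: distrib_right sum.distrib)
  qed
  ultimately show ?case by (intro exI[of _ ?c]) blast
qed

lemma det_mat_eq_sum:
  fixes A :: "nat \<Rightarrow> nat \<Rightarrow> real"
  shows "Determinant.det (Matrix.mat n n (\<lambda>(i, j). A i j)) =
    (\<Sum>p | p permutes {0..<n}. of_int (sign p) * (\<Prod>i = 0..<n. A i (p i)))"
proof -
  have "(\<Prod>i = 0..<n. Matrix.mat n n (\<lambda>(i, j). A i j) $$ (i, p i)) = (\<Prod>i = 0..<n. A i (p i))"
    if "p permutes {0..<n}" for p
    using permutes_in_image[OF that] by (intro prod.cong) auto
  then show ?thesis by (subst det_def'[of _ n]) auto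
qed

lemma det_in_falg:
  assumes "\<And>i j. i < n \<Longrightarrow> j < n \<Longrightarrow> A i j \<in> falg U"
  shows "(\<lambda>x. Determinant.det (Matrix.mat n n (\<lambda>(i, j). A i j x))) \<in> falg U"
  unfolding det_mat_eq_sum
  by (intro falg_sum falg_scale falg_prod assms) (auto simp: permutes_in_image)

lemma isCont_det:
  assumes "\<And>i j. i < n \<Longrightarrow> j < n \<Longrightarrow> isCont (A i j) (t :: real)"
  shows "isCont (\<lambda>x. Determinant.det (Matrix.mat n n (\<lambda>(i, j). A i j x :: real))) t"
  unfolding det_mat_eq_sum
  by (intro continuous_intros assms) (auto simp: permutes_in_image)

lemma det_scaled_mat:
  "Determinant.det (Matrix.mat n n (\<lambda>(i, j). c * A i j :: real)) = c ^ n * Determinant.det (Matrix.mat n n (\<lambda>(i, j). A i j))"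
proof -
  have "Matrix.mat n n (\<lambda>(i, j). c * A i j) = c \<cdot>\<^sub>m Matrix.mat n n (\<lambda>(i, j). A i j)"
    by (rule eq_matI) auto
  then show ?thesis by simp
qed

lemma det_eq_0_of_kernel:
  fixes A :: "nat \<Rightarrow> nat \<Rightarrow> real"
  assumes "\<And>i. i < n \<Longrightarrow> (\<Sum>j<n. A i j * v j) = 0" and "\<exists>j<n. v j \<noteq> 0"
  shows "Determinant.det (Matrix.mat n n (\<lambda>(i, j). A i j)) = 0"
proof -
  let ?A = "Matrix.mat n n (\<lambda>(i, j). A i j)" and ?v = "Matrix.vec n v"
  have "?A *\<^sub>v ?v = 0\<^sub>v n"
  proof (rule eq_vecI)
    fix i assume "i < dim_vec (0\<^sub>v n)"
    then have i: "i < n" by simp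
    have "vec_index (?A *\<^sub>v ?v) i = (\<Sum>j<n. A i j * v j)"
      using i by (simp add: scalar_prod_def lessThan_atLeast0)
    then show "vec_index (?A *\<^sub>v ?v) i = vec_index (0\<^sub>v n) i" using assms(1)[OF i] i by simp
  qed simp
  moreover have "?v \<noteq> 0\<^sub>v n" using assms(2) by (metis index_vec index_zero_vec(1))
  ultimately show ?thesis
    by (subst det_0_iff_vec_prod_zero[of _ n]) (auto intro!: exI[of _ ?v])
qed

text \<open>
  Rapidly decreasing weights turn the lexicographic comparison of monomials into a comparison of degrees:
  one more factor with index \<open>i\<close> outweighs all the exponents \<open>m j\<close> with \<open>j > i\<close>.
\<close>

lemma dominating_weights:
  fixes m :: "nat \<Rightarrow> nat"
  obtains K where "\<And>i. i < s \<Longrightarrow> (\<Sum>j\<in>{i<..<s}. K j * m j) < K i"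
proof -
  define \<mu> where "\<mu> = Suc (\<Sum>j<s. m j)"
  show thesis
  proof (rule that[of "\<lambda>i. \<mu> ^ (s - i)"])
    fix i assume i: "i < s"
    have "(\<Sum>j\<in>{i<..<s}. \<mu> ^ (s - j) * m j) \<le> (\<Sum>j\<in>{i<..<s}. \<mu> ^ (s - Suc i) * m j)"
      by (intro sum_mono mult_right_mono power_increasing) (auto simp: \<mu>_def)
    also have "\<dots> = \<mu> ^ (s - Suc i) * (\<Sum>j\<in>{i<..<s}. m j)" by (simp add: sum_distrib_left)
    also have "\<dots> \<le> \<mu> ^ (s - Suc i) * (\<Sum>j<s. m j)"
      by (intro mult_left_mono sum_mono2) auto
    also have "\<dots> < \<mu> ^ (s - Suc i) * \<mu>" by (simp add: \<mu>_def)
    also have "\<dots> = \<mu> ^ (s - i)" using i by (simp add: power_Suc2[symmetric] Suc_diff_Suc del: power_Suc2)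
    finally show "(\<Sum>j\<in>{i<..<s}. \<mu> ^ (s - j) * m j) < \<mu> ^ (s - i)" .
  qed
qed

text \<open>
  Without such a chain, \<open>iterated_boundary_meets_ideal\<close> yields an identity on \<open>M\<close> between the coordinates
  \<open>y i\<close> in \<open>T\<close>, centred at a point \<open>q\<close> where the denominator does not vanish. Its coefficients \<open>a i\<close> are
  polynomials in all coordinates. As they act on a finite module over the polynomials in \<open>T\<close>, with
  generators \<open>es\<close>, the identity becomes a square system \<open>N\<close> of linear equations for the values of
  \<open>es\<close>. Since \<open>1\<close> is among the generators, the determinant of \<open>N\<close> vanishes on the piece \<open>Z\<close>, hence
  everywhere by independence of \<open>T\<close>. On the curve \<open>y i = \<epsilon> ^ K i\<close> with dominating weights \<open>K\<close> the
  entries of \<open>N\<close> are divisible by \<open>\<epsilon> ^ W\<close>, and the quotient tends to a nonzero scalar matrix as \<open>\<epsilon>\<close>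
  tends to \<open>0\<close>, a contradiction.
\<close>

lemma chain_of_maximal_alg_indep:
  fixes T M :: "'a::euclidean_space set"
  assumes indep: "alg_indep T M" and max: "\<And>c. c \<in> Basis - T \<Longrightarrow> \<not> alg_indep (insert c T) M"
    and T: "T \<subseteq> Basis"
  shows "\<exists>P. (\<forall>i\<le>card T. primeideal (P i) (polynomial_ring Quot vanishing_ideal M)) \<and>
    (\<forall>i<card T. P i \<subset> P (Suc i))"
proof (rule ccontr)
  assume no_chain: "\<not> ?thesis"
  obtain b where b: "b \<in> falg (coords T)" "\<exists>x. b x \<noteq> 0"
    and fin: "finite_over {x \<in> M. b x \<noteq> 0} (coords T)
       {f \<in> falg (coords T). \<forall>x\<in>{x \<in> M. b x \<noteq> 0}. f x \<noteq> 0} (coords Basis)"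
    using generic_finiteness[OF indep max T] by blast
  define Z where "Z = {x \<in> M. b x \<noteq> 0}"
  obtain q where q: "q \<in> Z" using indep b unfolding alg_indep_def Z_def by blast
  obtain b0 E where b0: "b0 \<in> falg (coords T)" "\<And>x. x \<in> Z \<Longrightarrow> b0 x \<noteq> 0" "b0 \<in> multipliers Z (coords T) E"
    and E: "finite E" "(\<lambda>_. 1) \<in> E"
    and mul: "\<And>\<phi>. \<phi> \<in> coords Basis \<Longrightarrow> (\<lambda>z. b0 z * \<phi> z) \<in> multipliers Z (coords T) E"
    using fin unfolding Z_def[symmetric] finite_over_def by blast
  have finT: "finite T" by (rule finite_subset[OF T finite_Basis])
  obtain ts where ts: "set ts = T" "distinct ts" using finite_distinct_list[OF finT] by blast
  define s where "s = card T"
  have len: "length ts = s" unfolding s_def using ts by (metis distinct_card)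
  define y where "y i x = x \<bullet> (ts ! i) - q \<bullet> (ts ! i)" for i and x :: 'a
  define ys where "ys = map y [0..<s]"
  have lys: "length ys = s" "\<And>i. i < s \<Longrightarrow> ys ! i = y i" unfolding ys_def by auto
  have y_falg: "y i \<in> falg (coords T)" if "i < s" for i
  proof -
    have "(\<lambda>x. x \<bullet> (ts ! i)) \<in> falg (coords T)"
      using that ts len by (intro falg.gen) (auto simp: coords_def)
    from falg.add[OF this falg.const[of "- (q \<bullet> (ts ! i))"]] show ?thesis
      unfolding y_def by simp
  qed
  interpret I: ideal "vanishing_ideal M" "polynomial_ring :: ('a \<Rightarrow> real) ring" by (rule ideal_vanishing_ideal)
  have "set ys \<subseteq> carrier polynomial_ring"
    using real_polynomial_function_falg_coords[OF y_falg] by (auto simp: ys_def polynomial_ring_def)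
  from I.iterated_boundary_meets_ideal[OF cring_polynomial_ring _ this]
  obtain r where r: "r \<in> iterated_boundary polynomial_ring ys" "r \<in> vanishing_ideal M"
    using no_chain unfolding lys s_def by blast
  obtain m a where a: "\<And>i. i < s \<Longrightarrow> real_polynomial_function (a i)"
    and r': "\<And>x. r x = (\<Prod>i<length ys. (ys ! i) x ^ m i) +
       (\<Sum>i<length ys. a i x * ((ys ! i) x * (\<Prod>j\<le>i. (ys ! j) x ^ m j)))"
    using iterated_boundary_polynomial_ring[OF r(1)] lys by auto
  have r_eq: "(\<Prod>i<s. y i x ^ m i) + (\<Sum>i<s. a i x * (y i x * (\<Prod>j\<le>i. y j x ^ m j))) = 0" if "x \<in> Z" for x
  proof -
    have "r x = (\<Prod>i<s. y i x ^ m i) + (\<Sum>i<s. a i x * (y i x * (\<Prod>j\<le>i. y j x ^ m j)))"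
      unfolding r' lys(1) by (intro arg_cong2[where f = "(+)"] sum.cong prod.cong) (auto simp: lys(2))
    then show ?thesis using r(2) that unfolding vanishing_ideal_def Z_def by auto
  qed
  \<comment> \<open>The exponents that suffice for the single \<open>a i\<close> are added up, as larger ones work too.\<close>
  have "\<exists>t. \<forall>i<s. (\<lambda>z. b0 z ^ t * a i z) \<in> multipliers Z (coords T) E"
  proof -
    have "\<exists>t. (\<lambda>z. b0 z ^ t * a i z) \<in> multipliers Z (coords T) E" if "i < s" for i
      by (rule clear_denominators[OF b0(3) mul falg_coords_real_polynomial_function[OF a[OF that]]])
    then obtain t where t: "\<And>i. i < s \<Longrightarrow> (\<lambda>z. b0 z ^ t i * a i z) \<in> multipliers Z (coords T) E"
      by metis
    have "(\<lambda>z. b0 z ^ (\<Sum>i<s. t i) * a i z) \<in> multipliers Z (coords T) E" if "i < s" for i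
    proof -
      have "(\<Sum>i<s. t i) = t i + (\<Sum>j\<in>{..<s} - {i}. t j)" using that by (simp add: sum.remove)
      then show ?thesis
        using multipliers_mult[OF multipliers_power[OF b0(3)] t[OF that], of "\<Sum>j\<in>{..<s} - {i}. t j"]
        by (simp add: power_add ac_simps)
    qed
    then show ?thesis by blast
  qed
  then obtain t where t: "\<And>i. i < s \<Longrightarrow> (\<lambda>z. b0 z ^ t * a i z) \<in> multipliers Z (coords T) E" by blast
  obtain es where es: "set es = E" "distinct es" using finite_distinct_list[OF E(1)] by blast
  define n where "n = length es"
  have sum_es: "(\<Sum>l<n. h (es ! l)) = (\<Sum>e\<in>E. h e)" for h :: "('a \<Rightarrow> real) \<Rightarrow> real"
    using sum.reindex_bij_betw[OF bij_betw_nth[OF es(2), of "{..<n}" E], of h] es(1) by (simp add: n_def)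
  let ?Q = "\<lambda>i l c. (\<forall>e. c e \<in> falg (coords T)) \<and>
      (\<forall>z\<in>Z. b0 z ^ t * a i z * (es ! l) z = (\<Sum>e\<in>E. c e z * e z))"
  have "\<forall>p\<in>{..<s} \<times> {..<n}. \<exists>c. ?Q (fst p) (snd p) c"
  proof
    fix p assume "p \<in> {..<s} \<times> {..<n}"
    then have p: "fst p < s" "snd p < n" by auto
    have "(\<lambda>z. b0 z ^ t * a (fst p) z * (es ! snd p) z) \<in> fmod Z (coords T) E"
      using t[OF p(1)] p(2) es(1) nth_mem[of "snd p" es] unfolding multipliers_def n_def by blast
    from fmod_explicit[OF this E(1)] show "\<exists>c. ?Q (fst p) (snd p) c" .
  qed
  from bchoice[OF this] obtain c where c: "\<forall>p\<in>{..<s} \<times> {..<n}. ?Q (fst p) (snd p) (c p)" ..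
  define A where "A i l = c (i, l)" for i l
  have A: "A i l e \<in> falg (coords T)"
    "\<And>z. z \<in> Z \<Longrightarrow> b0 z ^ t * a i z * (es ! l) z = (\<Sum>e\<in>E. A i l e z * e z)"
    if "i < s" "l < n" for i l e
    using bspec[OF c, of "(i, l)"] that unfolding A_def by auto
  \<comment> \<open>Row \<open>l\<close> of \<open>N\<close> writes the vanishing function \<open>b0 ^ t * r * es ! l\<close> in terms of the generators.\<close>
  define N where "N l k x = (if l = k then b0 x ^ t * (\<Prod>i<s. y i x ^ m i) else 0) +
    (\<Sum>i<s. y i x * (\<Prod>j\<le>i. y j x ^ m j) * A i l (es ! k) x)" for l k and x :: 'a
  have N_falg: "N l k \<in> falg (coords T)" if "l < n" for l k
  proof -
    have "(\<lambda>x. (if l = k then 1 else 0) * (b0 x ^ t * (\<Prod>i<s. y i x ^ m i)) +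
      (\<Sum>i<s. y i x * (\<Prod>j\<le>i. y j x ^ m j) * A i l (es ! k) x)) \<in> falg (coords T)"
      by (intro falg.add falg.mult falg_sum falg_prod falg_power falg.const b0 y_falg A that) auto
    moreover have "N l k = (\<lambda>x. (if l = k then 1 else 0) * (b0 x ^ t * (\<Prod>i<s. y i x ^ m i)) +
      (\<Sum>i<s. y i x * (\<Prod>j\<le>i. y j x ^ m j) * A i l (es ! k) x))"
      unfolding N_def by auto
    ultimately show ?thesis by simp
  qed
  define \<delta> where "\<delta> x = Determinant.det (Matrix.mat n n (\<lambda>(l, k). N l k x))" for x
  have \<delta>: "\<delta> \<in> falg (coords T)" unfolding \<delta>_def by (rule det_in_falg[OF N_falg])
  have "\<delta> x = 0" if x: "x \<in> Z" for x
    unfolding \<delta>_def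
  proof (rule det_eq_0_of_kernel[where v = "\<lambda>k. (es ! k) x"])
    have "(\<lambda>_. 1) \<in> set es" using E es by simp
    then show "\<exists>j<n. (es ! j) x \<noteq> 0" unfolding in_set_conv_nth n_def by (metis zero_neq_one)
    fix l assume l: "l < n"
    have "(\<Sum>k<n. N l k x * (es ! k) x) = (\<Sum>k<n. (if l = k then b0 x ^ t * (\<Prod>i<s. y i x ^ m i) * (es ! l) x else 0)) +
       (\<Sum>k<n. \<Sum>i<s. y i x * (\<Prod>j\<le>i. y j x ^ m j) * (A i l (es ! k) x * (es ! k) x))"
      unfolding N_def by (subst sum.distrib[symmetric], intro sum.cong refl)
        (auto simp: distrib_right sum_distrib_right mult.assoc)
    also have "(\<Sum>k<n. (if l = k then b0 x ^ t * (\<Prod>i<s. y i x ^ m i) * (es ! l) x else 0))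
       = b0 x ^ t * (\<Prod>i<s. y i x ^ m i) * (es ! l) x" using l by simp
    also have "(\<Sum>k<n. \<Sum>i<s. y i x * (\<Prod>j\<le>i. y j x ^ m j) * (A i l (es ! k) x * (es ! k) x))
       = (\<Sum>i<s. y i x * (\<Prod>j\<le>i. y j x ^ m j) * (\<Sum>k<n. A i l (es ! k) x * (es ! k) x))"
      by (subst sum.swap) (simp add: sum_distrib_left)
    also have "\<dots> = (\<Sum>i<s. y i x * (\<Prod>j\<le>i. y j x ^ m j) * (b0 x ^ t * a i x * (es ! l) x))"
      using A(2)[OF _ l x] by (intro sum.cong) (auto simp: sum_es[of "\<lambda>e. A _ l e x * e x"])
    also have "b0 x ^ t * (\<Prod>i<s. y i x ^ m i) * (es ! l) x + \<dots> =
       b0 x ^ t * (es ! l) x * ((\<Prod>i<s. y i x ^ m i) + (\<Sum>i<s. a i x * (y i x * (\<Prod>j\<le>i. y j x ^ m j))))"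
      by (simp add: distrib_left sum_distrib_left ac_simps)
    finally show "(\<Sum>k<n. N l k x * (es ! k) x) = 0" using r_eq[OF x] by simp
  qed
  then have "\<forall>x\<in>M. b x * \<delta> x = 0" unfolding Z_def by auto
  then have b\<delta>: "\<forall>x. b x * \<delta> x = 0"
    by (rule mp[OF bspec[OF indep[unfolded alg_indep_def] falg.mult[OF b(1) \<delta>]]])
  have \<delta>0: "\<delta> x = 0" for x
  proof (rule ccontr)
    assume "\<delta> x \<noteq> 0"
    moreover obtain x' where "b x' \<noteq> 0" using b(2) by blast
    ultimately obtain z where "b z * \<delta> z \<noteq> 0"
      using real_polynomial_function_nonzero_mult[OF real_polynomial_function_falg_coords[OF b(1)] _
        real_polynomial_function_falg_coords[OF \<delta>]] by blast
    then show False using b\<delta> by simp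
  qed
  \<comment> \<open>Restrict the determinant to a monomial curve through \<open>q\<close>.\<close>
  obtain K where K: "\<And>i. i < s \<Longrightarrow> (\<Sum>j\<in>{i<..<s}. K j * m j) < K i"
    using dominating_weights[of s m] by blast
  \<comment> \<open>On the curve the leading monomial is \<open>\<epsilon> ^ W\<close>, and the term with index \<open>i\<close> is divisible by \<open>\<epsilon> ^ (W + R i)\<close>.\<close>
  define W where "W = (\<Sum>j<s. K j * m j)"
  define R where "R i = K i - (\<Sum>j\<in>{i<..<s}. K j * m j)" for i
  have R: "R i > 0" "K i + (\<Sum>j\<le>i. K j * m j) = W + R i" if "i < s" for i
  proof -
    show "R i > 0" using K[OF that] unfolding R_def by simp
    have "{..<s} = {..i} \<union> {i<..<s}" using that by auto
    then have "W = (\<Sum>j\<le>i. K j * m j) + (\<Sum>j\<in>{i<..<s}. K j * m j)"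
      unfolding W_def by (simp add: sum.union_disjoint disjoint_iff)
    then show "K i + (\<Sum>j\<le>i. K j * m j) = W + R i" using K[OF that] unfolding R_def by simp
  qed
  define \<gamma> where "\<gamma> \<epsilon> = q + (\<Sum>i<s. \<epsilon> ^ K i *\<^sub>R (ts ! i))" for \<epsilon> :: real
  have y\<gamma>: "y i (\<gamma> \<epsilon>) = \<epsilon> ^ K i" if "i < s" for i \<epsilon>
  proof -
    have "(\<Sum>j<s. \<epsilon> ^ K j *\<^sub>R (ts ! j)) \<bullet> (ts ! i) = (\<Sum>j<s. if j = i then \<epsilon> ^ K i else 0)"
      unfolding inner_sum_left
    proof (rule sum.cong)
      fix j assume j: "j \<in> {..<s}"
      have "ts ! j \<in> Basis" "ts ! i \<in> Basis" using j that T ts(1) len nth_mem by auto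
      moreover have "ts ! j = ts ! i \<longleftrightarrow> j = i" using j that ts(2) len by (simp add: nth_eq_iff_index_eq)
      ultimately show "\<epsilon> ^ K j *\<^sub>R (ts ! j) \<bullet> (ts ! i) = (if j = i then \<epsilon> ^ K i else 0)"
        by (auto simp: inner_Basis)
    qed simp
    then show ?thesis using that unfolding y_def \<gamma>_def by (simp add: inner_add_left)
  qed
  define N' where "N' l k \<epsilon> = (if l = k then b0 (\<gamma> \<epsilon>) ^ t else 0) + (\<Sum>i<s. \<epsilon> ^ R i * A i l (es ! k) (\<gamma> \<epsilon>))" for l k \<epsilon>
  have NN': "N l k (\<gamma> \<epsilon>) = \<epsilon> ^ W * N' l k \<epsilon>" for l k \<epsilon>
  proof -
    have "(\<Prod>i<s. y i (\<gamma> \<epsilon>) ^ m i) = \<epsilon> ^ W"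
      unfolding W_def power_sum by (rule prod.cong) (simp_all add: y\<gamma> power_mult)
    moreover have "y i (\<gamma> \<epsilon>) * (\<Prod>j\<le>i. y j (\<gamma> \<epsilon>) ^ m j) = \<epsilon> ^ W * \<epsilon> ^ R i" if "i < s" for i
    proof -
      have "(\<Prod>j\<le>i. y j (\<gamma> \<epsilon>) ^ m j) = \<epsilon> ^ (\<Sum>j\<le>i. K j * m j)"
        unfolding power_sum by (rule prod.cong) (use that in \<open>simp_all add: y\<gamma> power_mult\<close>)
      then show ?thesis using that R(2)[OF that] by (simp add: y\<gamma> power_add[symmetric])
    qed
    ultimately show ?thesis unfolding N_def N'_def
      by (simp add: distrib_left sum_distrib_left mult.assoc)
  qed
  define \<delta>' where "\<delta>' \<epsilon> = Determinant.det (Matrix.mat n n (\<lambda>(l, k). N' l k \<epsilon>))" for \<epsilon>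
  have \<delta>': "\<delta>' \<epsilon> = 0" if "\<epsilon> \<noteq> 0" for \<epsilon>
  proof -
    have "\<delta> (\<gamma> \<epsilon>) = (\<epsilon> ^ W) ^ n * \<delta>' \<epsilon>" unfolding \<delta>_def \<delta>'_def NN' by (rule det_scaled_mat)
    then show ?thesis using \<delta>0 that by simp
  qed
  have cont: "isCont (\<lambda>\<epsilon>. f (\<gamma> \<epsilon>)) 0" if "f \<in> falg (coords T)" for f
    using that
  proof induction
    case (gen u)
    then obtain c where "u = (\<lambda>x. x \<bullet> c)" unfolding coords_def by blast
    then show ?case unfolding \<gamma>_def by (simp add: continuous_intros)
  qed (auto intro: continuous_intros)
  have "isCont (N' l k) 0" if "l < n" for l k
  proof -
    have "isCont (\<lambda>\<epsilon>. (if l = k then 1 else 0) * b0 (\<gamma> \<epsilon>) ^ t + (\<Sum>i<s. \<epsilon> ^ R i * A i l (es ! k) (\<gamma> \<epsilon>))) 0"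
      by (intro continuous_intros cont b0 A that) auto
    moreover have "N' l k = (\<lambda>\<epsilon>. (if l = k then 1 else 0) * b0 (\<gamma> \<epsilon>) ^ t + (\<Sum>i<s. \<epsilon> ^ R i * A i l (es ! k) (\<gamma> \<epsilon>)))"
      unfolding N'_def by auto
    ultimately show ?thesis by simp
  qed
  then have "isCont \<delta>' 0" unfolding \<delta>'_def by (intro isCont_det)
  then have "\<delta>' \<midarrow>0\<rightarrow> \<delta>' 0" by (simp add: isCont_def)
  moreover have "\<delta>' \<midarrow>0\<rightarrow> 0"
    by (rule Lim_transform_eventually[OF tendsto_const]) (auto simp: eventually_at \<delta>' intro!: exI[of _ 1])
  ultimately have "\<delta>' 0 = 0" by (rule LIM_unique)
  moreover have "\<delta>' 0 = (b0 q ^ t) ^ n"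
  proof -
    have Kpos: "K i > 0" if "i < s" for i using K[OF that] by simp
    have "(\<Sum>i<s. (0::real) ^ K i *\<^sub>R (ts ! i)) = 0"
      by (rule sum.neutral) (use Kpos in auto)
    then have "\<gamma> 0 = q" unfolding \<gamma>_def by simp
    moreover have "(\<Sum>i<s. 0 ^ R i * A i l (es ! k) q) = 0" for l k
      by (rule sum.neutral) (use R(1) in auto)
    ultimately have "N' l k 0 = b0 q ^ t * (if l = k then 1 else 0)" for l k
      unfolding N'_def by simp
    then have "\<delta>' 0 = (b0 q ^ t) ^ n * Determinant.det (Matrix.mat n n (\<lambda>(l, k). if l = k then 1 else 0))"
      unfolding \<delta>'_def by (simp only: det_scaled_mat)
    also have "Matrix.mat n n (\<lambda>(l, k). if l = k then 1 else 0) = (1\<^sub>m n :: real mat)"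
      unfolding one_mat_def ..
    finally show ?thesis by simp
  qed
  ultimately show False using b0(2)[OF q] by simp
qed

lemma card_alg_indep_le_semialg_dim:
  fixes T M :: "'a::euclidean_space set"
  assumes indep: "alg_indep T M" and T: "T \<subseteq> Basis"
  shows "ereal (real (card T)) \<le> semialg_dim M"
proof -
  let ?I = "{S. T \<subseteq> S \<and> S \<subseteq> Basis \<and> alg_indep S M}"
  have fin: "finite ?I" by (rule finite_subset[of _ "Pow Basis"]) auto
  have "T \<in> ?I" using assms by simp
  then have "?I \<noteq> {}" by blast
  from finite_has_maximal[OF fin this]
  obtain S where S: "S \<in> ?I" and max: "\<forall>S'\<in>?I. S \<subseteq> S' \<longrightarrow> S = S'" by (rule bexE)
  have "\<not> alg_indep (insert c S) M" if "c \<in> Basis - S" for c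
    using bspec[OF max, of "insert c S"] that S by auto
  then have "\<exists>P. (\<forall>i\<le>card S. primeideal (P i) (polynomial_ring Quot vanishing_ideal M)) \<and>
    (\<forall>i<card S. P i \<subset> P (Suc i))"
    using S by (intro chain_of_maximal_alg_indep) auto
  then have "ereal (real (card S)) \<le> semialg_dim M"
    unfolding semialg_dim_def krull_dim_def by (intro Sup_upper) blast
  moreover have "card T \<le> card S"
    using S by (intro card_mono) (auto intro: finite_subset[OF _ finite_Basis])
  ultimately show ?thesis by (meson ereal_less_eq(3) of_nat_mono order_trans)
qed

section \<open>Incidence strata and generic injectivity\<close>

lemma falg_pullback: "f \<in> falg U \<Longrightarrow> (\<lambda>y. f (p y)) \<in> falg ((\<lambda>u y. u (p y)) ` U)"
  by (induction rule: falg.induct) (auto intro: falg.intros)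

text \<open>
  All coordinate functions on the incidence set \<open>Z\<close> are finite over the coordinates of \<open>x\<close> in \<open>T1\<close>, those of
  \<open>y\<close> in \<open>T2\<close>, and those of \<open>w $ i\<close> other than the one along \<open>c i\<close>. These are fewer than
  \<open>CARD('p) * DIM('a)\<close>, so the coordinates of \<open>w\<close> are algebraically dependent on \<open>Z\<close>.
\<close>

lemma incidence_polynomial:
  fixes Z1 Z2 :: "'a::euclidean_space set" and A B :: "'p::finite \<Rightarrow> 'a \<Rightarrow> 'a" and c :: "'p \<Rightarrow> 'a"
  assumes lin: "\<And>i. linear (A i)" "\<And>i. linear (B i)" and c: "\<And>i. c i \<in> Basis"
    and T: "T1 \<subseteq> Basis" "T2 \<subseteq> Basis" "card T1 + card T2 < CARD('p)"
    and fin1: "finite_over Z1 (coords T1) {f. \<forall>x\<in>Z1. f x \<noteq> 0} (coords Basis)"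
    and fin2: "finite_over Z2 (coords T2) {f. \<forall>x\<in>Z2. f x \<noteq> 0} (coords Basis)"
  shows "\<exists>P :: 'a ^ 'p \<Rightarrow> real. real_polynomial_function P \<and> (\<exists>w. P w \<noteq> 0) \<and>
    (\<forall>w. \<forall>x\<in>Z1. \<forall>y\<in>Z2. (\<forall>i. w $ i \<bullet> (A i x - B i y) = 0 \<and> (A i x - B i y) \<bullet> c i \<noteq> 0) \<longrightarrow> P w = 0)"
proof -
  define v where "v i x y = A i x - B i y" for i x y
  define Z where "Z = {(x, y, w :: 'a ^ 'p). x \<in> Z1 \<and> y \<in> Z2 \<and> (\<forall>i. w $ i \<bullet> v i x y = 0 \<and> v i x y \<bullet> c i \<noteq> 0)}"
  let ?X = "\<lambda>z :: 'a \<times> 'a \<times> ('a ^ 'p). fst z" and ?Y = "\<lambda>z :: 'a \<times> 'a \<times> ('a ^ 'p). fst (snd z)"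
  define D where "D = {f. \<forall>z\<in>Z. f z \<noteq> (0::real)}"
  have D: "denominators D" unfolding denominators_def D_def by auto
  define W where "W i d z = snd (snd z) $ i \<bullet> d" for i d and z :: "'a \<times> 'a \<times> ('a ^ 'p)"
  define Vx where "Vx = (\<lambda>u z. u (?X z)) ` coords T1"
  define Vy where "Vy = (\<lambda>u z. u (?Y z)) ` coords T2"
  define Vw where "Vw = (\<lambda>(i, d). W i d) ` (SIGMA i:UNIV. Basis - {c i})"
  define V where "V = Vx \<union> Vy \<union> Vw"
  define \<Phi> where "\<Phi> = (\<lambda>u z. u (?X z)) ` coords Basis \<union> ((\<lambda>u z. u (?Y z)) ` coords Basis \<union> falg V)"
  have "finite_over Z V D ((\<lambda>u z. u (?X z)) ` coords Basis)"
    by (rule finite_over_pullback[OF fin1]) (auto simp: Z_def V_def Vx_def D_def)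
  moreover have "finite_over Z V D ((\<lambda>u z. u (?Y z)) ` coords Basis)"
    by (rule finite_over_pullback[OF fin2]) (auto simp: Z_def V_def Vy_def D_def)
  ultimately have fin: "finite_over Z V D \<Phi>"
    unfolding \<Phi>_def by (intro finite_over_Un[OF D] finite_over_falg[OF D])
  have lin_coord: "(\<lambda>x. L x \<bullet> d) \<in> falg (coords Basis)" if "linear L" for L :: "'a \<Rightarrow> 'a" and d
    by (intro falg_coords_real_polynomial_function real_polynomial_function.intros(1)
      bounded_linear_compose[OF bounded_linear_inner_left] linear_conv_bounded_linear[THEN iffD1] that)
  have v\<Phi>: "(\<lambda>z. v i (?X z) (?Y z) \<bullet> d) \<in> falg \<Phi>" for i d
  proof -
    have "(\<lambda>z. A i (?X z) \<bullet> d) \<in> falg \<Phi>"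
      using falg_pullback[OF lin_coord[OF lin(1)[of i], of d], of ?X]
        falg_mono[of "(\<lambda>u z. u (?X z)) ` coords Basis" \<Phi>] unfolding \<Phi>_def by blast
    moreover have "(\<lambda>z. B i (?Y z) \<bullet> d) \<in> falg \<Phi>"
      using falg_pullback[OF lin_coord[OF lin(2)[of i], of d], of ?Y]
        falg_mono[of "(\<lambda>u z. u (?Y z)) ` coords Basis" \<Phi>] unfolding \<Phi>_def by blast
    ultimately have "(\<lambda>z. A i (?X z) \<bullet> d + (- 1) * (B i (?Y z) \<bullet> d)) \<in> falg \<Phi>"
      by (intro falg.add falg_scale)
    then show ?thesis by (simp add: v_def inner_diff_left)
  qed
  have W\<Phi>: "W i d \<in> \<Phi>" if "d \<in> Basis" "d \<noteq> c i" for i d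
  proof -
    have "W i d \<in> V" unfolding V_def Vw_def using that by force
    then show ?thesis unfolding \<Phi>_def by (auto intro: falg.gen)
  qed
  let ?F = "range (\<lambda>i. W i (c i))"
  have "finite_over Z V D (?F \<union> \<Phi>)"
  proof (rule finite_over_adjoin_algebraic[OF D fin])
    fix f assume "f \<in> ?F"
    then obtain i where f: "f = W i (c i)" by blast
    \<comment> \<open>The orthogonality relation is linear in the coordinate of \<open>w $ i\<close> along \<open>c i\<close>.\<close>
    define a where "a j z = (if j = 0 then \<Sum>d\<in>Basis - {c i}. W i d z * (v i (?X z) (?Y z) \<bullet> d)
      else v i (?X z) (?Y z) \<bullet> c i)" for j :: nat and z
    have "a 0 \<in> falg \<Phi>" unfolding a_def by (auto intro!: falg_sum falg.mult v\<Phi> falg.gen[OF W\<Phi>])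
    moreover have a1: "a 1 \<in> falg \<Phi>" unfolding a_def using v\<Phi>[of i "c i"] by simp
    ultimately have "a j \<in> falg \<Phi>" if "j \<le> 1" for j using that by (cases j) auto
    moreover have "a 1 \<in> D" unfolding D_def a_def Z_def by auto
    moreover have "(\<Sum>j\<le>1. a j z * f z ^ j) = 0" if "z \<in> Z" for z
    proof -
      have "0 = snd (snd z) $ i \<bullet> v i (?X z) (?Y z)" using that unfolding Z_def by auto
      also have "\<dots> = (\<Sum>d\<in>Basis. W i d z * (v i (?X z) (?Y z) \<bullet> d))"
        unfolding W_def by (rule euclidean_inner)
      also have "\<dots> = a 1 z * f z + a 0 z"
        unfolding a_def f using c[of i] by (simp add: sum.remove)
      finally show ?thesis by simp
    qed
    ultimately show "algebraic_over Z D \<Phi> f"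
      unfolding algebraic_over_def by (intro exI[of _ 1] conjI exI[of _ a]) auto
  qed simp
  moreover have "finite V"
    unfolding V_def Vx_def Vy_def Vw_def coords_def
    using finite_subset[OF T(1)] finite_subset[OF T(2)] by auto
  moreover define q where "q = CARD('p) * DIM('a)"
  have "card V < q"
  proof -
    have coords: "card (coords S) \<le> card S" "finite (coords S)" if "S \<subseteq> Basis" for S :: "'a set"
      using finite_subset[OF that] unfolding coords_def by (auto intro: card_image_le)
    have "card Vx \<le> card T1" unfolding Vx_def
      using card_image_le[OF coords(2)[OF T(1)]] coords(1)[OF T(1)] by (rule order_trans)
    moreover have "card Vy \<le> card T2" unfolding Vy_def
      using card_image_le[OF coords(2)[OF T(2)]] coords(1)[OF T(2)] by (rule order_trans)
    moreover have "card Vw \<le> CARD('p) * (DIM('a) - 1)"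
    proof -
      have "card Vw \<le> card (SIGMA i:(UNIV :: 'p set). Basis - {c i})"
        unfolding Vw_def by (rule card_image_le) auto
      also have "\<dots> = CARD('p) * (DIM('a) - 1)" using c by (simp add: card_SigmaI)
      finally show ?thesis .
    qed
    moreover have "card V \<le> card Vx + card Vy + card Vw"
      unfolding V_def using card_Un_le[of Vx Vy] card_Un_le[of "Vx \<union> Vy" Vw] by linarith
    moreover have "CARD('p) + CARD('p) * (DIM('a) - 1) = q"
      unfolding q_def using DIM_positive[where 'a = 'a] by (cases "DIM('a)") auto
    ultimately show ?thesis using T(3) by linarith
  qed
  moreover obtain h where h: "bij_betw h {..<q} ((UNIV :: 'p set) \<times> (Basis :: 'a set))"
    using ex_bij_betw_nat_finite[of "(UNIV :: 'p set) \<times> (Basis :: 'a set)"]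
    unfolding q_def card_cartesian_product lessThan_atLeast0 by auto
  have hB: "snd (h j) \<in> Basis" if "j < q" for j
    using bij_betw_apply[OF h, of j] that by (auto simp: mem_Times_iff)
  define \<phi> where "\<phi> j = W (fst (h j)) (snd (h j))" for j
  have "\<phi> j \<in> ?F \<union> \<Phi>" if "j < q" for j
    using W\<Phi>[OF hB[OF that], of "fst (h j)"] unfolding \<phi>_def
    by (cases "snd (h j) = c (fst (h j))") auto
  moreover have "b z \<noteq> 0" if "b \<in> D" "z \<in> Z" for b z using that unfolding D_def by blast
  ultimately obtain n e where e: "\<exists>m<n ^ q. e m \<noteq> 0"
    and zero: "\<And>z. z \<in> Z \<Longrightarrow> (\<Sum>m<n ^ q. e m * (\<Prod>j<q. \<phi> j z ^ digit n m j)) = 0"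
    using algebraic_dependence[of Z V D "?F \<union> \<Phi>" q \<phi>] by blast
  define P where "P w = (\<Sum>m<n ^ q. e m * (\<Prod>j<q. (w $ fst (h j) \<bullet> snd (h j)) ^ digit n m j))" for w :: "'a ^ 'p"
  have "real_polynomial_function P"
    unfolding P_def
    by (intro real_polynomial_function_sum real_polynomial_function.intros(4) real_polynomial_function.intros(2)
      real_polynomial_function_prod real_polynomial_function_power real_polynomial_function.intros(1)
      bounded_linear_compose[OF bounded_linear_inner_left bounded_linear_vec_nth]) auto
  moreover have "\<exists>w. P w \<noteq> 0"
  proof -
    obtain t :: real where t: "(\<Sum>m<n ^ q. e m * (\<Prod>j<q. (t ^ (n ^ j)) ^ digit n m j)) \<noteq> 0"
      using kronecker_substitution[OF e] by blast
    \<comment> \<open>The point of Kronecker's substitution: the coordinate number \<open>j\<close> of \<open>w\<close> is \<open>t ^ (n ^ j)\<close>.\<close>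
    define w :: "'a ^ 'p" where "w = (\<chi> i. \<Sum>d\<in>Basis. (t ^ (n ^ the_inv_into {..<q} h (i, d))) *\<^sub>R d)"
    have "w $ fst (h j) \<bullet> snd (h j) = t ^ (n ^ j)" if "j < q" for j
      using that hB[OF that] the_inv_into_f_f[OF bij_betw_imp_inj_on[OF h]]
      unfolding w_def by simp
    then have "P w = (\<Sum>m<n ^ q. e m * (\<Prod>j<q. (t ^ (n ^ j)) ^ digit n m j))"
      unfolding P_def by simp
    then show ?thesis using t by metis
  qed
  moreover have "P w = 0" if "x \<in> Z1" "y \<in> Z2" "\<forall>i. w $ i \<bullet> v i x y = 0 \<and> v i x y \<bullet> c i \<noteq> 0" for w x y
    using zero[of "(x, y, w)"] that unfolding Z_def P_def \<phi>_def W_def by simp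
  ultimately show ?thesis unfolding v_def by blast
qed

lemma sorted_coorbit_attained:
  fixes U :: "'g \<Rightarrow> 'a::euclidean_space \<Rightarrow> 'a"
  assumes "finite (carrier G)" "j \<in> {1..order G}"
  shows "\<exists>g\<in>carrier G. sorted_coorbit G U w j x = U g w \<bullet> x"
proof -
  let ?M = "image_mset (\<lambda>g. U g w \<bullet> x) (mset_set (carrier G))"
  let ?l = "rev (sorted_list_of_multiset ?M)"
  have "length ?l = size (mset (sorted_list_of_multiset ?M))" by (simp only: length_rev size_mset)
  then have "length ?l = order G" by (simp add: order_def)
  then have "?l ! (j - 1) \<in> set ?l" using assms(2) by (intro nth_mem) auto
  then have "?l ! (j - 1) \<in># ?M" by simp
  then show ?thesis unfolding sorted_coorbit_def using assms(1) by auto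
qed

lemma orbit_eq_of_common_point:
  assumes act: "group_action G UNIV U" and g: "g \<in> carrier G" "h \<in> carrier G" and eq: "U g x = U h y"
  shows "orbit G U x = orbit G U y"
proof -
  interpret group_action G UNIV U by (rule act)
  have sub: "orbit G U x \<subseteq> orbit G U y" if "g \<in> carrier G" "h \<in> carrier G" "U g x = U h y" for g h x y
  proof
    fix z assume z: "z \<in> orbit G U x"
    have "U h y \<in> orbit G U y" using that(2) unfolding orbit_def by blast
    moreover have "U g x \<in> orbit G U x" using that(1) unfolding orbit_def by blast
    then have "x \<in> orbit G U (U g x)" by (rule orbit_sym[OF UNIV_I UNIV_I])
    ultimately have "x \<in> orbit G U y" using that(3) orbit_trans[OF UNIV_I UNIV_I UNIV_I, of "U h y" y x] by simp
    then show "z \<in> orbit G U y" using z orbit_trans[OF UNIV_I UNIV_I UNIV_I] by blast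
  qed
  from sub[OF g eq] sub[OF g(2,1) eq[symmetric]] show ?thesis by blast
qed

text \<open>
  The strata are indexed by two pieces of \<open>M\<close>, the group elements that realise the chosen entries for
  \<open>x\<close> and for \<open>y\<close>, and the basis vectors that detect the difference of the two points. The index set
  does not depend on the set of chosen entries, so one polynomial serves all of them.
\<close>

theorem theorem2p5:
  fixes G :: "('g, 'b) monoid_scheme"
    and U :: "'g \<Rightarrow> 'a::euclidean_space \<Rightarrow> 'a"
    and M :: "'a set"
    and k :: ereal
  assumes "DIM('a) \<ge> 2"
    and "group_action G UNIV U"
    and "finite (carrier G)"
    and "\<And>g. g \<in> carrier G \<Longrightarrow> orthogonal_transformation (U g)"
    and "semialgebraic M"
    and "semialg_dim M = k"
    and "k \<le> ereal (real DIM('a))"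
    and "\<And>g. g \<in> carrier G \<Longrightarrow> U g ` M \<subseteq> M"
    and "ereal (real CARD('p::finite)) \<ge> 2 * k + 1"
  shows "zariski_generic (\<lambda>w :: 'a ^ 'p.
           \<forall>S \<subseteq> {1..order G} \<times> (UNIV :: 'p set).
             (\<forall>i. {j. (j, i) \<in> S} \<noteq> {}) \<longrightarrow>
             inj_on (induced_coorbit_map G U w S) {orbit G U x | x. x \<in> M})"
proof -
  note act = assms(2) and orth = assms(4)
  interpret group_action G UNIV U by (rule act)
  interpret group G using group_hom group_hom.axioms(1) by auto
  obtain \<Z> where \<Z>: "finite \<Z>" "M = \<Union>\<Z>"
    "\<And>Z. Z \<in> \<Z> \<Longrightarrow> \<exists>T\<subseteq>Basis. alg_indep T M \<and> finite_over Z (coords T) {f. \<forall>x\<in>Z. f x \<noteq> 0} (coords Basis)"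
    using stratification[of M] by blast
  have small: "card T1 + card T2 < CARD('p)"
    if T: "alg_indep T1 M" "T1 \<subseteq> Basis" "alg_indep T2 M" "T2 \<subseteq> Basis" for T1 T2
  proof -
    \<comment> \<open>With the maximum only one inequality has to be moved from the extended reals to \<open>nat\<close>.\<close>
    define m where "m = max (card T1) (card T2)"
    have "ereal (real m) \<le> k"
      using card_alg_indep_le_semialg_dim[OF T(1,2)] card_alg_indep_le_semialg_dim[OF T(3,4)] assms(6)
      unfolding m_def by (simp add: max_def)
    then have "2 * ereal (real m) + 1 \<le> 2 * k + 1"
      by (intro add_right_mono ereal_mult_left_mono) auto
    also have "\<dots> \<le> ereal (real CARD('p))" using assms(9) .
    finally have "2 * m + 1 \<le> CARD('p)" by (simp add: one_ereal_def)
    then show ?thesis unfolding m_def by simp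
  qed
  define J where "J = \<Z> \<times> \<Z> \<times> ((UNIV :: 'p set) \<rightarrow>\<^sub>E carrier G) \<times> ((UNIV :: 'p set) \<rightarrow>\<^sub>E carrier G) \<times>
    ((UNIV :: 'p set) \<rightarrow>\<^sub>E (Basis :: 'a set))"
  have finJ: "finite J" unfolding J_def using \<Z>(1) assms(3)
    by (intro finite_cartesian_product finite_PiE) auto
  let ?Q = "\<lambda>(Z1, Z2, g, h, c) P. real_polynomial_function P \<and> (\<exists>w. P w \<noteq> 0) \<and>
    (\<forall>w :: 'a ^ 'p. \<forall>x\<in>Z1. \<forall>y\<in>Z2. (\<forall>i. w $ i \<bullet> (U (g i) x - U (h i) y) = 0 \<and>
      (U (g i) x - U (h i) y) \<bullet> c i \<noteq> 0) \<longrightarrow> P w = 0)"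
  have "\<forall>\<iota>\<in>J. \<exists>P. ?Q \<iota> P"
  proof
    fix \<iota> assume "\<iota> \<in> J"
    then obtain Z1 Z2 g h c where eq: "\<iota> = (Z1, Z2, g, h, c)" and Z: "Z1 \<in> \<Z>" "Z2 \<in> \<Z>"
      and ghc: "g \<in> UNIV \<rightarrow>\<^sub>E carrier G" "h \<in> UNIV \<rightarrow>\<^sub>E carrier G" "c \<in> UNIV \<rightarrow>\<^sub>E Basis"
      unfolding J_def by blast
    have gh: "g i \<in> carrier G" "h i \<in> carrier G" and c: "c i \<in> Basis" for i using ghc by auto
    obtain T1 where T1: "T1 \<subseteq> Basis" "alg_indep T1 M"
      "finite_over Z1 (coords T1) {f. \<forall>x\<in>Z1. f x \<noteq> 0} (coords Basis)" using \<Z>(3)[OF Z(1)] by blast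
    obtain T2 where T2: "T2 \<subseteq> Basis" "alg_indep T2 M"
      "finite_over Z2 (coords T2) {f. \<forall>x\<in>Z2. f x \<noteq> 0} (coords Basis)" using \<Z>(3)[OF Z(2)] by blast
    have "linear (U (g i))" "linear (U (h i))" for i
      using orth gh by (auto intro: orthogonal_transformation_linear)
    from incidence_polynomial[OF this c T1(1) T2(1) small[OF T1(2,1) T2(2,1)] T1(3) T2(3)]
    show "\<exists>P. ?Q \<iota> P" unfolding eq by simp
  qed
  from bchoice[OF this] obtain P where P: "\<forall>\<iota>\<in>J. ?Q \<iota> (P \<iota>)" ..
  define F where "F w = (\<Prod>\<iota>\<in>J. P \<iota> w)" for w
  have F: "real_polynomial_function F"
    unfolding F_def using P by (intro real_polynomial_function_prod finJ) auto
  have "\<exists>w. F w \<noteq> 0"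
    unfolding F_def using P by (intro real_polynomial_function_nonzero_prod finJ) auto
  moreover have "zariski_open {w. F w \<noteq> 0}"
    unfolding zariski_open_def zariski_closed_def using F by (intro exI[of _ "{F}"]) auto
  moreover have "inj_on (induced_coorbit_map G U w S) {orbit G U x | x. x \<in> M}"
    if w: "F w \<noteq> 0" and S: "S \<subseteq> {1..order G} \<times> UNIV" "\<And>i. {j. (j, i) \<in> S} \<noteq> {}" for w S
  proof (rule inj_onI)
    fix X Y
    assume "X \<in> {orbit G U x | x. x \<in> M}" and "Y \<in> {orbit G U x | x. x \<in> M}"
      and XY: "induced_coorbit_map G U w S X = induced_coorbit_map G U w S Y"
    then obtain x y where x: "X = orbit G U x" "x \<in> M" and y: "Y = orbit G U y" "y \<in> M" by blast
    have eq: "coorbit_map G U w S x = coorbit_map G U w S y"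
      using XY unfolding x y by (simp add: induced_coorbit_map_orbit[OF act orth])
    have move: "U g u \<bullet> z = u \<bullet> U (inv\<^bsub>G\<^esub> g) z" if g: "g \<in> carrier G" for g u z
    proof -
      have "U g (U (inv\<^bsub>G\<^esub> g) z) = z" using orbit_sym_aux[of "inv\<^bsub>G\<^esub> g" z] g by simp
      then have "U g u \<bullet> z = U g u \<bullet> U g (U (inv\<^bsub>G\<^esub> g) z)" by simp
      also have "\<dots> = u \<bullet> U (inv\<^bsub>G\<^esub> g) z" using orth[OF g] by (simp add: orthogonal_transformation_def)
      finally show ?thesis .
    qed
    have "\<exists>g h. g \<in> carrier G \<and> h \<in> carrier G \<and> w $ i \<bullet> (U g x - U h y) = 0" for i
    proof -
      obtain j where j: "(j, i) \<in> S" using S(2)[of i] by blast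
      then have j': "j \<in> {1..order G}" using S(1) by blast
      have "sorted_coorbit G U (w $ i) j x = sorted_coorbit G U (w $ i) j y"
        using fun_cong[OF eq, of "(j, i)"] j by (simp add: coorbit_map_def)
      moreover obtain g where "g \<in> carrier G" "sorted_coorbit G U (w $ i) j x = U g (w $ i) \<bullet> x"
        using sorted_coorbit_attained[OF assms(3) j'] by blast
      moreover obtain h where "h \<in> carrier G" "sorted_coorbit G U (w $ i) j y = U h (w $ i) \<bullet> y"
        using sorted_coorbit_attained[OF assms(3) j'] by blast
      ultimately show ?thesis
        by (intro exI[of _ "inv\<^bsub>G\<^esub> g"] exI[of _ "inv\<^bsub>G\<^esub> h"]) (simp add: move inner_diff_right)
    qed
    then obtain g h where gh: "\<And>i. g i \<in> carrier G" "\<And>i. h i \<in> carrier G"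
      "\<And>i. w $ i \<bullet> (U (g i) x - U (h i) y) = 0" by metis
    show "X = Y"
    proof (rule ccontr)
      assume "X \<noteq> Y"
      then have ne: "U (g i) x - U (h i) y \<noteq> 0" for i
        using orbit_eq_of_common_point[OF act gh(1)[of i] gh(2)[of i], of x y] unfolding x y by auto
      have "\<exists>c. c \<in> Basis \<and> (U (g i) x - U (h i) y) \<bullet> c \<noteq> 0" for i
        using ne[of i] euclidean_all_zero_iff[of "U (g i) x - U (h i) y"] by blast
      then obtain c where c: "\<And>i. c i \<in> Basis" "\<And>i. (U (g i) x - U (h i) y) \<bullet> c i \<noteq> 0" by metis
      obtain Z1 Z2 where Z: "Z1 \<in> \<Z>" "x \<in> Z1" "Z2 \<in> \<Z>" "y \<in> Z2" using x(2) y(2) \<Z>(2) by blast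
      have \<iota>: "(Z1, Z2, g, h, c) \<in> J" unfolding J_def using Z gh c by auto
      have "\<forall>w. \<forall>x\<in>Z1. \<forall>y\<in>Z2. (\<forall>i. w $ i \<bullet> (U (g i) x - U (h i) y) = 0 \<and>
          (U (g i) x - U (h i) y) \<bullet> c i \<noteq> 0) \<longrightarrow> P (Z1, Z2, g, h, c) w = 0"
        using bspec[OF P \<iota>] by simp
      then have "P (Z1, Z2, g, h, c) w = 0" using Z(2,4) gh(3) c(2) by blast
      then have "F w = 0" unfolding F_def using \<iota> finJ by (auto simp: prod_zero_iff)
      then show False using w by simp
    qed
  qed
  ultimately show ?thesis unfolding zariski_generic_def
    by (intro exI[of _ "{w. F w \<noteq> 0}"]) auto
qed

end
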